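(* There exist a badly approximable irrational number $\alpha\in(0,1)$ and a $\mathbb{Z}_2$ skew product $T$ of the rotation by $\alpha$ over two intervals such that $T$ is minimal and not uniquely ergodic.
   Context: An irrational $\alpha$ is badly approximable if $\liminf_{n\to\infty} n\, d(n\alpha,\mathbb{Z})>0$, where $d(\cdot,\mathbb{Z})$ is the distance to the nearest integer. A $\mathbb{Z}_2$ skew product of the rotation by $\alpha$ over two intervals is a map $T:[0,1)\times\mathbb{Z}_2\to[0,1)\times\mathbb{Z}_2$ of the form $T(x,i)=(x+\alpha \bmod 1,\ i+\chi_{I\cup I'}(x))$, where $\mathbb{Z}_2=\mathbb{Z}/2\mathbb{Z}$, $I,I'\subset[0,1)$ are two disjoint nonempty half-open intervals and $\chi$ denotes a characteristic function. $T$ is minimal if every orbit $\{T^n(x,i):n\in\mathbb{Z}\}$ is dense in $[0,1)\times\mathbb{Z}_2$. $T$ is uniquely ergodic if it has exactly one invariant Borel probability measure. *)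

theory Defs
  imports "HOL-Probability.Probability_Measure" "HOL-Library.Z2"
begin

definition badly_approximable :: "real \<Rightarrow> bool" where
  "badly_approximable \<alpha> \<longleftrightarrow>
     \<alpha> \<notin> \<rat> \<and> liminf (\<lambda>n. ereal (real n * infdist (real n * \<alpha>) \<int>)) > 0"

text \<open>The group \<open>\<int>/2\<int>\<close> is the type \<^typ>\<open>bit\<close>, in which \<open>1 + 1 = 0\<close>.\<close>

definition phase_space :: "(real \<times> bit) topology" where
  "phase_space = prod_topology (top_of_set {0..<1}) (discrete_topology UNIV)"

definition half_open_interval :: "real set \<Rightarrow> bool" where
  "half_open_interval I \<longleftrightarrow> (\<exists>a b. 0 \<le> a \<and> a < b \<and> b \<le> 1 \<and> I = {a..<b})"

text \<open>The formula makes sense on all of \<^typ>\<open>real \<times> bit\<close>; only its restriction to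
  \<^term>\<open>topspace phase_space\<close>, which it maps bijectively onto itself (see below), matters.\<close>

definition skew_product :: "real \<Rightarrow> real set \<Rightarrow> real \<times> bit \<Rightarrow> real \<times> bit" where
  "skew_product \<alpha> J = (\<lambda>(x, i). (frac (x + \<alpha>), i + indicator J x))"

definition two_interval_skew_product :: "real \<Rightarrow> (real \<times> bit \<Rightarrow> real \<times> bit) \<Rightarrow> bool" where
  "two_interval_skew_product \<alpha> T \<longleftrightarrow>
     (\<exists>I I'. half_open_interval I \<and> half_open_interval I' \<and> I \<inter> I' = {} \<and>
             T = skew_product \<alpha> (I \<union> I'))"

text \<open>Integer iterates of a bijection \<open>T\<close> of the set \<open>S\<close>, and full orbits.\<close>

definition int_iterate :: "'a set \<Rightarrow> ('a \<Rightarrow> 'a) \<Rightarrow> int \<Rightarrow> 'a \<Rightarrow> 'a" where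
  "int_iterate S T n = (if n \<ge> 0 then T ^^ nat n else inv_into S T ^^ nat (- n))"

definition minimal_map :: "'a topology \<Rightarrow> ('a \<Rightarrow> 'a) \<Rightarrow> bool" where
  "minimal_map X T \<longleftrightarrow>
     (\<forall>p\<in>topspace X. X closure_of (range (\<lambda>n. int_iterate (topspace X) T n p)) = topspace X)"

definition borel_of :: "'a topology \<Rightarrow> 'a measure" where
  "borel_of X = sigma (topspace X) {U. openin X U}"

text \<open>The equality \<open>distr \<mu> \<mu> T = \<mu>\<close> expresses invariance only for measurable \<open>T\<close>; skew products
  over finite unions of intervals are always Borel measurable.\<close>

definition invariant_prob :: "'a topology \<Rightarrow> ('a \<Rightarrow> 'a) \<Rightarrow> 'a measure \<Rightarrow> bool" where
  "invariant_prob X T \<mu> \<longleftrightarrow>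
     sets \<mu> = sets (borel_of X) \<and> prob_space \<mu> \<and> T \<in> measurable \<mu> \<mu> \<and> distr \<mu> \<mu> T = \<mu>"

definition uniquely_ergodic :: "'a topology \<Rightarrow> ('a \<Rightarrow> 'a) \<Rightarrow> bool" where
  "uniquely_ergodic X T \<longleftrightarrow> (\<exists>!\<mu>. invariant_prob X T \<mu>)"

lemma topspace_phase_space: "topspace phase_space = {0..<1} \<times> UNIV"
  by (simp add: phase_space_def)

lemma bij_betw_skew_product:
  "bij_betw (skew_product \<alpha> J) (topspace phase_space) (topspace phase_space)"
proof (rule bij_betw_byWitness[where f' =
      "\<lambda>(y, j). (frac (y - \<alpha>), j - indicator J (frac (y - \<alpha>)))"])
  have shift: "frac (frac z + w) = frac (z + w)" for z w :: real
  proof -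
    have "frac z + w = (z + w) - of_int \<lfloor>z\<rfloor>" by (simp add: frac_def)
    then show ?thesis by (simp only: frac_def floor_diff_of_int of_int_diff)
  qed
  have inv1: "frac (frac (x + \<alpha>) - \<alpha>) = x" if "0 \<le> x" "x < 1" for x
    using shift[of "x + \<alpha>" "- \<alpha>"] that by (simp add: frac_eq)
  have inv2: "frac (frac (x - \<alpha>) + \<alpha>) = x" if "0 \<le> x" "x < 1" for x
    using shift[of "x - \<alpha>" "\<alpha>"] that by (simp add: frac_eq)
  have bb: "i + k + k = i" for i k :: bit
    by (cases i; cases k) simp_all
  show "\<forall>p\<in>topspace phase_space.
      (\<lambda>(y, j). (frac (y - \<alpha>), j - indicator J (frac (y - \<alpha>)))) (skew_product \<alpha> J p) = p"
    by (auto simp: topspace_phase_space skew_product_def inv1 bb)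
  show "\<forall>p\<in>topspace phase_space.
      skew_product \<alpha> J ((\<lambda>(y, j). (frac (y - \<alpha>), j - indicator J (frac (y - \<alpha>)))) p) = p"
    by (auto simp: topspace_phase_space skew_product_def inv2 bb)
qed (auto simp: topspace_phase_space skew_product_def frac_lt_1)

end

theory Submission
  imports Defs "HOL-Analysis.Kronecker_Approximation_Theorem"
begin

text \<open>
  Put \<open>J = [0, u) \<union> [w, w + u)\<close>. On the circle, \<open>\<chi>\<^sub>J\<close> has the same parity as a function that is
  symmetric in \<open>u\<close> and \<open>w\<close> (called \<open>cocycle\<close> below). If \<open>u = k \<alpha>\<close> modulo \<open>1\<close>, then moving \<open>w\<close> to
  \<open>w + e\<close> changes it by the difference of an interval of length \<open>e\<close> and its translate by \<open>k \<alpha>\<close>,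
  which is the coboundary of a function supported on a set of measure at most \<open>\<bar>k\<bar> e\<close>; the same
  holds with \<open>u\<close> and \<open>w\<close> exchanged. So one lets \<open>u\<close> and \<open>w\<close> grow alternately through the multiples
  of \<open>\<alpha>\<close> modulo \<open>1\<close> by increments that are tiny compared with the reciprocals of the coefficients \<open>k\<close>
  reached so far. The transfer functions converge almost everywhere by Borel--Cantelli, so in the
  limit \<open>\<chi>\<^sub>J\<close> is a measurable coboundary modulo \<open>2\<close>, and unique ergodicity fails.

  On the other hand the limits \<open>u\<close>, \<open>w\<close>, \<open>u + w\<close> lie outside \<open>\<int> + \<int> \<alpha>\<close>, so that the orbit of the
  discontinuity \<open>0\<close> meets no other discontinuity of \<open>\<chi>\<^sub>J\<close>, and this forces minimality.

  The construction works for any irrational \<open>\<alpha>\<close>; for the quadratic unit \<open>\<alpha> = \<surd>2 - 1\<close> one can take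
  \<open>u = \<Sum>\<^sub>n \<alpha>\<^bsup>2 \<cdot> 4^n\<^esup>\<close> and \<open>w = \<Sum>\<^sub>n \<alpha>\<^bsup>4^n\<^esup>\<close>, because the powers of \<open>\<alpha>\<close> lie in \<open>\<int> + \<int> \<alpha>\<close>.
\<close>

section \<open>The cocycle and minimality\<close>

definition int_span :: "real \<Rightarrow> real set" where
  "int_span \<alpha> = {of_int a + of_int b * \<alpha> |a b. True}"

text \<open>A mixed second difference of the floor function. For \<open>0 \<le> u \<le> 1\<close>,
  \<open>\<lfloor>x\<rfloor> - \<lfloor>x - u\<rfloor>\<close> is the 1-periodic indicator of
  \<open>[0, u)\<close>, so this is that indicator minus its translate by \<open>w\<close>; modulo 2
  the sign is invisible.\<close>

definition cocycle :: "real \<Rightarrow> real \<Rightarrow> real \<Rightarrow> int" where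
  "cocycle u w x = \<lfloor>x\<rfloor> - \<lfloor>x - u\<rfloor> - \<lfloor>x - w\<rfloor> + \<lfloor>x - (u + w)\<rfloor>"

definition birkhoff_sum :: "real \<Rightarrow> (real \<Rightarrow> int) \<Rightarrow> nat \<Rightarrow> real \<Rightarrow> int" where
  "birkhoff_sum \<alpha> f n x = (\<Sum>j<n. f (x + real j * \<alpha>))"

lemma cocycle_add_int: "cocycle u w (x + of_int l) = cocycle u w x"
proof -
  have "x + of_int l - d = (x - d) + of_int l" for d by simp
  then show ?thesis
    unfolding cocycle_def by (simp only: floor_add_int) simp
qed

lemma cocycle_diff_int: "cocycle u w (x - of_int l) = cocycle u w x"
  using cocycle_add_int[of u w x "- l"] by simp

lemma cocycle_commute: "cocycle u w x = cocycle w u x"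
  by (simp add: cocycle_def add.commute)

text \<open>On \<open>[0, 1)\<close> the cocycle is 1 on the first interval and -1 on the second,
  and both values are 1 in \<open>bit\<close>. The bounds \<open>u \<le> w\<close> and
  \<open>u + w \<le> 1\<close> keep the intervals disjoint and prevent wrapping around the
  circle.\<close>

lemma indicator_two_intervals_eq_cocycle:
  assumes "0 \<le> u" "u \<le> w" "u + w \<le> 1" "0 \<le> x" "x < 1"
  shows "(indicator ({0..<u} \<union> {w..<w + u}) x :: bit) = of_int (cocycle u w x)"
proof -
  have fl: "\<lfloor>x - d\<rfloor> = (if x < d then - 1 else 0)" if "0 \<le> d" "d \<le> 1" for d
    using that assms by (auto simp: floor_eq_iff)
  have "\<lfloor>x\<rfloor> = 0" using assms by (auto simp: floor_eq_iff)
  then show ?thesis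
    using assms by (auto simp: cocycle_def fl indicator_def)
qed

lemma birkhoff_sum_add:
  "birkhoff_sum \<alpha> f (m + n) x = birkhoff_sum \<alpha> f m x + birkhoff_sum \<alpha> f n (x + real m * \<alpha>)"
proof (induction n)
  case (Suc n)
  have "x + real (m + n) * \<alpha> = x + real m * \<alpha> + real n * \<alpha>" by (simp add: distrib_right)
  with Suc show ?case by (simp only: birkhoff_sum_def add_Suc_right sum.lessThan_Suc add.assoc)
qed (simp add: birkhoff_sum_def)

lemma birkhoff_sum_cocycle_diff_int:
  "birkhoff_sum \<alpha> (cocycle u w) n (x - of_int l) = birkhoff_sum \<alpha> (cocycle u w) n x"
proof -
  have "x - of_int l + y = (x + y) - of_int l" for y by simp
  then show ?thesis by (simp only: birkhoff_sum_def cocycle_diff_int)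
qed

section \<open>One-sided limits of Birkhoff sums\<close>

lemma eventually_floor_at_right:
  fixes z d :: real
  shows "\<forall>\<^sub>F y in at_right z. \<lfloor>y + c - d\<rfloor> = \<lfloor>z + c - d\<rfloor>"
  unfolding eventually_at_right_field
proof (intro exI conjI allI impI)
  show "z < d - c + of_int \<lfloor>z + c - d\<rfloor> + 1" by linarith
  show "\<lfloor>y + c - d\<rfloor> = \<lfloor>z + c - d\<rfloor>"
    if "z < y" "y < d - c + of_int \<lfloor>z + c - d\<rfloor> + 1" for y
    using that by linarith
qed

lemma eventually_floor_at_left:
  fixes z d :: real
  shows "\<forall>\<^sub>F y in at_left z. \<lfloor>y + c - d\<rfloor> = \<lfloor>z + c - d\<rfloor> - of_bool (z + c - d \<in> \<int>)"
proof -
  \<comment> \<open>The distance from \<open>z + c - d\<close> down to the nearest strictly smaller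
    integer, so that \<open>y + c - d\<close> stays within one unit interval.\<close>
  define e where "e = (if z + c - d \<in> \<int> then 1 else z + c - d - of_int \<lfloor>z + c - d\<rfloor>)"
  have "z + c - d \<noteq> of_int \<lfloor>z + c - d\<rfloor>" if "z + c - d \<notin> \<int>"
    using that by (metis Ints_of_int)
  then have "e > 0"
    using of_int_floor_le[of "z + c - d"] by (simp add: e_def less_le)
  show ?thesis
    unfolding eventually_at_left_field
  proof (intro exI conjI allI impI)
    show "z - e < z" using \<open>e > 0\<close> by simp
    fix y assume y: "z - e < y" "y < z"
    show "\<lfloor>y + c - d\<rfloor> = \<lfloor>z + c - d\<rfloor> - of_bool (z + c - d \<in> \<int>)"
    proof (cases "z + c - d \<in> \<int>")
      case True
      then obtain k where "z + c - d = of_int k" by (auto elim: Ints_cases)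
      with True y show ?thesis by (simp add: e_def floor_eq_iff)
    next
      case False
      with y show ?thesis by (simp add: e_def) linarith
    qed
  qed
qed

text \<open>The value of \<open>cocycle u w\<close> at \<open>z\<close> minus its left limit there;
  the cocycle is right-continuous.\<close>

definition cocycle_jump :: "real \<Rightarrow> real \<Rightarrow> real \<Rightarrow> int" where
  "cocycle_jump u w z = of_bool (z \<in> \<int>) - of_bool (z - u \<in> \<int>) - of_bool (z - w \<in> \<int>)
     + of_bool (z - (u + w) \<in> \<int>)"

lemma eventually_birkhoff_sum_at_right:
  "\<forall>\<^sub>F y in at_right q. birkhoff_sum \<alpha> (cocycle u w) N y = birkhoff_sum \<alpha> (cocycle u w) N q"
proof -
  have "\<forall>\<^sub>F y in at_right q. cocycle u w (y + c) = cocycle u w (q + c)" for c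
    using eventually_floor_at_right[of c 0 q] eventually_floor_at_right[of c u q]
      eventually_floor_at_right[of c w q] eventually_floor_at_right[of c "u + w" q]
    by eventually_elim (simp only: cocycle_def diff_0_right)
  then have "\<forall>\<^sub>F y in at_right q. \<forall>j\<in>{..<N}. cocycle u w (y + real j * \<alpha>)
      = cocycle u w (q + real j * \<alpha>)"
    by (intro eventually_ball_finite) auto
  then show ?thesis
    by eventually_elim (simp add: birkhoff_sum_def)
qed

lemma eventually_birkhoff_sum_at_left:
  "\<forall>\<^sub>F y in at_left q. birkhoff_sum \<alpha> (cocycle u w) N y =
     birkhoff_sum \<alpha> (cocycle u w) N q - (\<Sum>j<N. cocycle_jump u w (q + real j * \<alpha>))"
proof -
  have "\<forall>\<^sub>F y in at_left q. cocycle u w (y + c) = cocycle u w (q + c) - cocycle_jump u w (q + c)" for c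
    using eventually_floor_at_left[of c 0 q] eventually_floor_at_left[of c u q]
      eventually_floor_at_left[of c w q] eventually_floor_at_left[of c "u + w" q]
    by eventually_elim (simp only: cocycle_def cocycle_jump_def diff_0_right)
  then have "\<forall>\<^sub>F y in at_left q. \<forall>j\<in>{..<N}. cocycle u w (y + real j * \<alpha>) =
      cocycle u w (q + real j * \<alpha>) - cocycle_jump u w (q + real j * \<alpha>)"
    by (intro eventually_ball_finite) auto
  then show ?thesis
    by eventually_elim (simp add: birkhoff_sum_def sum_subtractf)
qed

section \<open>Density of rotation orbits with prescribed parity\<close>

lemma irrational_orbit_dense:
  fixes \<alpha> x a b :: real
  assumes "\<alpha> \<notin> \<rat>" "a < b"
  obtains n :: nat and l :: int where "0 < n" "a < x + real n * \<alpha> - of_int l"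
      "x + real n * \<alpha> - of_int l < b"
proof -
  obtain h k where k: "k > 0" "\<bar>of_int k * \<alpha> - of_int h - ((a + b) / 2 - x)\<bar> < (b - a) / 2"
    using sequence_of_fractional_parts_is_dense[of \<alpha> "(b - a) / 2" "(a + b) / 2 - x"] assms
    by (metis diff_gt_0_iff_gt half_gt_zero_iff)
  then have "real (nat k) = of_int k" by simp
  with k have "a < x + real (nat k) * \<alpha> - of_int h" "x + real (nat k) * \<alpha> - of_int h < b"
    by (auto simp: abs_less_iff field_simps)
  with k show thesis by (intro that[of "nat k" h]) auto
qed

lemma int_multiple_irrational_Ints_iff:
  fixes \<alpha> :: real
  assumes "\<alpha> \<notin> \<rat>"
  shows "of_int k * \<alpha> \<in> \<int> \<longleftrightarrow> k = 0"
proof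
  assume "of_int k * \<alpha> \<in> \<int>"
  then obtain l where l: "of_int k * \<alpha> = of_int l" by (auto elim: Ints_cases)
  show "k = 0"
  proof (rule ccontr)
    assume "k \<noteq> 0"
    with l have "\<alpha> = of_int l / of_int k" by (simp add: field_simps)
    with assms show False by simp
  qed
qed simp

text \<open>The discontinuities \<open>u\<close>, \<open>w\<close>, \<open>u + w\<close> lie on
  other orbits than \<open>0\<close>, so of the four terms of the jump only
  \<open>z \<in> \<int>\<close> can survive, and irrationality confines it to
  \<open>k = 0\<close>.\<close>

lemma cocycle_jump_backward_orbit:
  assumes "\<alpha> \<notin> \<rat>" "u \<notin> int_span \<alpha>" "w \<notin> int_span \<alpha>" "u + w \<notin> int_span \<alpha>"
  shows "cocycle_jump u w (of_int l + of_int k * \<alpha>) = of_bool (k = 0)"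
proof -
  have no: "of_int l + of_int k * \<alpha> - d \<notin> \<int>" if "d \<notin> int_span \<alpha>" for d
  proof
    assume "of_int l + of_int k * \<alpha> - d \<in> \<int>"
    then obtain i where "of_int l + of_int k * \<alpha> - d = of_int i" by (auto elim: Ints_cases)
    then have "d = of_int (l - i) + of_int k * \<alpha>" by (simp add: algebra_simps)
    with that show False unfolding int_span_def by blast
  qed
  have "of_int l + of_int k * \<alpha> \<in> \<int> \<longleftrightarrow> of_int k * \<alpha> \<in> \<int>"
    by (metis Ints_add Ints_diff Ints_of_int add_diff_cancel_left')
  then show ?thesis
    using no assms by (simp add: cocycle_jump_def int_multiple_irrational_Ints_iff)
qed

text \<open>If the parity were constant along all visits of one orbit to the interval, the sums
  between two visits would be even. But the backward and the forward orbit of the discontinuity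
  \<open>0\<close> both visit the interval, and the Birkhoff sum between these two visits jumps by \<open>1\<close>.\<close>

lemma birkhoff_sum_parity_dense:
  assumes irr: "\<alpha> \<notin> \<rat>"
    and span: "u \<notin> int_span \<alpha>" "w \<notin> int_span \<alpha>" "u + w \<notin> int_span \<alpha>" and "a < b"
  obtains n :: nat and l :: int
  where "a < x + real n * \<alpha> - of_int l" "x + real n * \<alpha> - of_int l < b"
    "even (birkhoff_sum \<alpha> (cocycle u w) n x) \<longleftrightarrow> P"
proof -
  let ?S = "birkhoff_sum \<alpha> (cocycle u w)"
  have "\<exists>n l. a < x + real n * \<alpha> - of_int l \<and> x + real n * \<alpha> - of_int l < b \<and> (even (?S n x) \<longleftrightarrow> P)"
  proof (rule ccontr)
    assume "\<not> ?thesis"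
    then have const: "even (?S n x) \<longleftrightarrow> \<not> P"
      if "a < x + real n * \<alpha> - of_int l" "x + real n * \<alpha> - of_int l < b" for n l
      using that by blast
    have "- \<alpha> \<notin> \<rat>" using irr by simp
    then obtain m :: nat and lm :: int where m: "0 < m" "a < 0 + real m * (- \<alpha>) - of_int lm"
        "0 + real m * (- \<alpha>) - of_int lm < b"
      using irrational_orbit_dense[OF _ \<open>a < b\<close>, of "- \<alpha>" 0] by blast
    obtain k :: nat and lk :: int where k: "0 < k" "a < 0 + real k * \<alpha> - of_int lk"
        "0 + real k * \<alpha> - of_int lk < b"
      using irrational_orbit_dense[OF irr \<open>a < b\<close>, of 0] by blast
    \<comment> \<open>The point \<open>q\<close> lies \<open>m\<close> steps before an integer and
      returns to the interval, modulo 1, after \<open>N\<close> steps. In between, at time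
      \<open>m\<close>, it passes the discontinuity \<open>0\<close>.\<close>
    define N where "N = m + k"
    define q where "q = of_int (- lm) - real m * \<alpha>"
    define s where "s = lk - lm"
    have q: "a < q" "q < b" using m by (simp_all add: q_def)
    have qN: "a < q + real N * \<alpha> - of_int s" "q + real N * \<alpha> - of_int s < b"
      using k by (simp_all add: q_def N_def s_def algebra_simps)
    have "(\<Sum>j<N. cocycle_jump u w (q + real j * \<alpha>)) = (\<Sum>j<N. of_bool (j = m))"
    proof (rule sum.cong[OF refl])
      fix j
      have "q + real j * \<alpha> = of_int (- lm) + of_int (int j - int m) * \<alpha>"
        by (simp add: q_def algebra_simps)
      then show "cocycle_jump u w (q + real j * \<alpha>) = of_bool (j = m)"
        using cocycle_jump_backward_orbit[OF irr span, of "- lm" "int j - int m"] by simp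
    qed
    also have "\<dots> = 1" using k by (simp add: N_def)
    finally have jump: "(\<Sum>j<N. cocycle_jump u w (q + real j * \<alpha>)) = 1" .
    \<comment> \<open>Both ends of this stretch of \<open>N\<close> steps lie in
      \<open>(a, b)\<close> modulo 1, so their common parity cancels in
      \<open>birkhoff_sum_add\<close>.\<close>
    have even_return: "even (?S N y)"
      if y: "y = x + real n * \<alpha> - of_int l" "a < y" "y < b"
        "a < y + real N * \<alpha> - of_int s" "y + real N * \<alpha> - of_int s < b" for y n l
    proof -
      have "even (?S n x) \<longleftrightarrow> \<not> P" using const[of n l] y by simp
      moreover have "even (?S (n + N) x) \<longleftrightarrow> \<not> P"
        using const[of "n + N" "l + s"] y by (simp add: algebra_simps)
      moreover have "?S (n + N) x = ?S n x + ?S N y"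
        unfolding birkhoff_sum_add y(1) by (simp add: birkhoff_sum_cocycle_diff_int)
      ultimately show ?thesis by auto
    qed
    define e where "e = min (min (b - q) (q - a)) (min (b - (q + real N * \<alpha> - of_int s)) (q + real N * \<alpha> - of_int s - a))"
    have "e > 0" using q qN by (simp add: e_def)
    have "\<forall>\<^sub>F y in at_right q. y < q + e"
      unfolding eventually_at_right_field using \<open>e > 0\<close> by (intro exI[of _ "q + e"]) auto
    with eventually_birkhoff_sum_at_right[of \<alpha> u w N q]
    have "\<forall>\<^sub>F y in at_right q. ?S N y = ?S N q \<and> y < q + e" by eventually_elim simp
    then obtain b1 where b1: "b1 > q" "\<And>y. q < y \<Longrightarrow> y < b1 \<Longrightarrow> ?S N y = ?S N q \<and> y < q + e"
      unfolding eventually_at_right_field by blast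
    have "\<forall>\<^sub>F y in at_left q. q - e < y"
      unfolding eventually_at_left_field using \<open>e > 0\<close> by (intro exI[of _ "q - e"]) auto
    with eventually_birkhoff_sum_at_left[of \<alpha> u w N q]
    have "\<forall>\<^sub>F y in at_left q. ?S N y = ?S N q - 1 \<and> q - e < y"
      by eventually_elim (simp add: jump)
    then obtain b2 where b2: "b2 < q" "\<And>y. b2 < y \<Longrightarrow> y < q \<Longrightarrow> ?S N y = ?S N q - 1 \<and> q - e < y"
      unfolding eventually_at_left_field by blast
    \<comment> \<open>Orbit points of \<open>x\<close> just to the right and just to the left of
      \<open>q\<close>: their sums over \<open>N\<close> steps differ by 1, yet
      \<open>even_return\<close> makes both even.\<close>
    obtain n1 l1 where y1: "q < x + real n1 * \<alpha> - of_int l1" "x + real n1 * \<alpha> - of_int l1 < b1"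
      using irrational_orbit_dense[OF irr b1(1), of x] by blast
    obtain n2 l2 where y2: "b2 < x + real n2 * \<alpha> - of_int l2" "x + real n2 * \<alpha> - of_int l2 < q"
      using irrational_orbit_dense[OF irr b2(1), of x] by blast
    have "even (?S N (x + real n1 * \<alpha> - of_int l1))"
      using b1(2)[OF y1] y1 q qN by (intro even_return[OF refl]) (auto simp: e_def)
    moreover have "even (?S N (x + real n2 * \<alpha> - of_int l2))"
      using b2(2)[OF y2] y2 q qN by (intro even_return[OF refl]) (auto simp: e_def)
    ultimately show False using b1(2)[OF y1] b2(2)[OF y2] by auto
  qed
  then show thesis using that by blast
qed

section \<open>From Birkhoff sums to orbits of the skew product\<close>

lemma skew_product_funpow:
  assumes "0 \<le> u" "u \<le> w" "u + w \<le> 1" "0 \<le> x" "x < 1"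
  shows "(skew_product \<alpha> ({0..<u} \<union> {w..<w + u}) ^^ n) (x, i) =
    (frac (x + real n * \<alpha>), i + of_int (birkhoff_sum \<alpha> (cocycle u w) n x))"
proof (induction n)
  case 0
  then show ?case using assms by (simp add: birkhoff_sum_def frac_eq)
next
  case (Suc n)
  let ?y = "x + real n * \<alpha>"
  have "frac ?y + \<alpha> = (?y + \<alpha>) - of_int \<lfloor>?y\<rfloor>" by (simp add: frac_def)
  then have "frac (frac ?y + \<alpha>) = frac (?y + \<alpha>)"
    by (simp only: frac_def floor_diff_of_int of_int_diff)
  moreover have "(indicator ({0..<u} \<union> {w..<w + u}) (frac ?y) :: bit) = of_int (cocycle u w ?y)"
    unfolding indicator_two_intervals_eq_cocycle[OF assms(1-3) frac_ge_0 frac_lt_1]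
    by (simp only: frac_def cocycle_diff_int)
  ultimately have "skew_product \<alpha> ({0..<u} \<union> {w..<w + u}) (frac ?y, j) =
      (frac (?y + \<alpha>), j + of_int (cocycle u w ?y))" for j
    by (simp only: skew_product_def prod.case)
  moreover have "x + real (Suc n) * \<alpha> = ?y + \<alpha>" by (simp add: algebra_simps)
  moreover have "birkhoff_sum \<alpha> (cocycle u w) (Suc n) x
      = birkhoff_sum \<alpha> (cocycle u w) n x + cocycle u w ?y"
    by (simp add: birkhoff_sum_def)
  ultimately show ?case
    by (simp only: funpow.simps o_apply Suc of_int_add add.assoc)
qed

lemma openin_phase_space_slice:
  assumes "openin phase_space V"
  shows "openin (top_of_set {0..<1}) {x. (x, i) \<in> V}"
proof -
  have V: "V \<subseteq> {0..<1} \<times> UNIV"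
    using openin_subset[OF assms] by (simp add: topspace_phase_space)
  have "continuous_map (top_of_set {0..<1}) phase_space (\<lambda>x. (x, i))"
    unfolding phase_space_def by (intro continuous_map_pairedI) auto
  then have "openin (top_of_set {0..<1}) {x \<in> topspace (top_of_set {0..<1}). (x, i) \<in> V}"
    using assms unfolding continuous_map_def by blast
  moreover have "{x \<in> topspace (top_of_set {0..<1}). (x, i) \<in> V} = {x. (x, i) \<in> V}"
    using V by auto
  ultimately show ?thesis by simp
qed

text \<open>A forward iterate enters every neighbourhood, because
  \<open>birkhoff_sum_parity_dense\<close> prescribes the position on the circle and the fibre at
  the same time.\<close>

lemma minimal_two_interval_skew_product:
  assumes uw: "0 \<le> u" "u \<le> w" "u + w \<le> 1" and irr: "\<alpha> \<notin> \<rat>"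
    and span: "u \<notin> int_span \<alpha>" "w \<notin> int_span \<alpha>" "u + w \<notin> int_span \<alpha>"
  shows "minimal_map phase_space (skew_product \<alpha> ({0..<u} \<union> {w..<w + u}))"
  unfolding minimal_map_def
proof
  let ?T = "skew_product \<alpha> ({0..<u} \<union> {w..<w + u})"
  fix p assume "p \<in> topspace phase_space"
  then obtain x i where p: "p = (x, i)" and x: "0 \<le> x" "x < 1"
    by (auto simp: topspace_phase_space)
  let ?orb = "range (\<lambda>n. int_iterate (topspace phase_space) ?T n p)"
  have "r \<in> phase_space closure_of ?orb" if r: "r \<in> topspace phase_space" for r
    unfolding in_closure_of
  proof (intro conjI allI impI r)
    fix V assume V: "r \<in> V \<and> openin phase_space V"
    obtain y k where yk: "r = (y, k)" and y: "0 \<le> y" "y < 1"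
      using r by (auto simp: topspace_phase_space)
    obtain W where W: "open W" "{x. (x, k) \<in> V} = {0..<1} \<inter> W"
      using openin_phase_space_slice[of V k] V by (auto simp: openin_open)
    then have "y \<in> W" using V yk by auto
    with W obtain e where e: "e > 0" "ball y e \<subseteq> W" by (meson openE)
    \<comment> \<open>The point \<open>y\<close> is approached from the right and below 1, so that
      subtracting \<open>l\<close> really gives the fractional part.\<close>
    define b where "b = min 1 (y + e)"
    have "y < b" using e y by (simp add: b_def)
    then obtain n :: nat and l :: int where nl: "y < x + real n * \<alpha> - of_int l"
        "x + real n * \<alpha> - of_int l < b"
      "even (birkhoff_sum \<alpha> (cocycle u w) n x) \<longleftrightarrow> i = k"
      using birkhoff_sum_parity_dense[OF irr span] by blast
    have "frac (x + real n * \<alpha>) = x + real n * \<alpha> - of_int l"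
      using nl y by (intro frac_unique_iff[THEN iffD2]) (auto simp: b_def)
    moreover have "x + real n * \<alpha> - of_int l \<in> {0..<1} \<inter> W"
      using nl y e by (auto simp: b_def dist_real_def subset_iff)
    moreover have "i + of_int (birkhoff_sum \<alpha> (cocycle u w) n x) = k"
      using nl(3) by (cases i; cases k) (auto elim!: evenE oddE)
    ultimately have "(?T ^^ n) p \<in> V"
      using W(2) by (auto simp: p skew_product_funpow[OF uw x])
    moreover have "(?T ^^ n) p \<in> ?orb"
      by (intro range_eqI[of _ _ "int n"]) (simp add: int_iterate_def)
    ultimately show "\<exists>z. z \<in> ?orb \<and> z \<in> V" by blast
  qed
  then show "phase_space closure_of ?orb = topspace phase_space"
    by (intro equalityI subsetI closure_of_subset_topspace[THEN subsetD])
qed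

section \<open>Measurable coboundaries\<close>

abbreviation circle_measure :: "real measure" where
  "circle_measure \<equiv> restrict_space lborel {0..<1}"

lemma prob_space_circle_measure: "prob_space circle_measure"
  by (rule prob_spaceI) (simp add: space_restrict_space emeasure_restrict_space)

lemma sets_circle_measure: "B \<in> sets circle_measure \<longleftrightarrow> B \<in> sets borel \<and> B \<subseteq> {0..<1}"
  by (subst sets_restrict_space_iff) auto

lemma measurable_rotation: "(\<lambda>x. frac (x + c)) \<in> measurable circle_measure circle_measure"
proof (intro measurable_restrict_space2 measurable_restrict_space1)
  show "(\<lambda>x. frac (x + c)) \<in> measurable lborel lborel"
    unfolding frac_def by measurable
qed (simp add: frac_lt_1)

lemma emeasure_lborel_shift:
  fixes A :: "real set"
  assumes "A \<in> sets borel"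
  shows "emeasure lborel {x. x + s \<in> A} = emeasure lborel A"
proof -
  have "emeasure lborel A = emeasure (distr lborel borel ((+) s)) A"
    by (simp add: lborel_distr_plus)
  also have "\<dots> = emeasure lborel ((+) s -` A)"
    using assms by (subst emeasure_distr) auto
  also have "(+) s -` A = {x. x + s \<in> A}" by (auto simp: add.commute)
  finally show ?thesis ..
qed

text \<open>With \<open>t = frac c\<close>, the rotation exchanges \<open>[0, 1 - t)\<close> and
  \<open>[1 - t, 1)\<close>, translating each. So \<open>B\<close> is cut at \<open>t\<close>, and
  translation invariance of Lebesgue measure applies to both pieces.\<close>

lemma distr_rotation: "distr circle_measure circle_measure (\<lambda>x. frac (x + c)) = circle_measure"
proof (rule measure_eqI)
  fix B assume "B \<in> sets (distr circle_measure circle_measure (\<lambda>x. frac (x + c)))"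
  then have B: "B \<in> sets circle_measure" by simp
  then have Bb [measurable]: "B \<in> sets borel" and B1: "B \<subseteq> {0..<1}"
    by (auto simp: sets_circle_measure)
  define t where "t = frac c"
  have t: "0 \<le> t" "t < 1" by (simp_all add: t_def frac_lt_1)
  have fr: "frac (x + c) = (if x < 1 - t then x + t else x + (t - 1))" if "0 \<le> x" "x < 1" for x
  proof -
    have "x + c - (if x < 1 - t then x + t else x + (t - 1))
        = of_int (\<lfloor>c\<rfloor> + (if x < 1 - t then 0 else 1))"
      by (simp add: t_def frac_def)
    then have "x + c - (if x < 1 - t then x + t else x + (t - 1)) \<in> \<int>" by (metis Ints_of_int)
    with that t show ?thesis by (intro frac_unique_iff[THEN iffD2]) auto
  qed
  have vim: "(\<lambda>x. frac (x + c)) -` B \<inter> {0..<1} =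
      {x. x + t \<in> B \<inter> {t..<1}} \<union> {x. x + (t - 1) \<in> B \<inter> {0..<t}}"
    using B1 t by (auto simp: fr split: if_splits)
  have "emeasure (distr circle_measure circle_measure (\<lambda>x. frac (x + c))) B
      = emeasure circle_measure ((\<lambda>x. frac (x + c)) -` B \<inter> {0..<1})"
    using B by (subst emeasure_distr) (auto simp: measurable_rotation space_restrict_space)
  also have "\<dots> = emeasure lborel ((\<lambda>x. frac (x + c)) -` B \<inter> {0..<1})"
    by (subst emeasure_restrict_space) auto
  also have "\<dots> = emeasure lborel {x. x + t \<in> B \<inter> {t..<1}} + emeasure lborel {x. x + (t - 1) \<in> B \<inter> {0..<t}}"
    unfolding vim by (intro plus_emeasure[symmetric]) (auto simp: t)
  also have "\<dots> = emeasure lborel (B \<inter> {t..<1}) + emeasure lborel (B \<inter> {0..<t})"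
    by (intro arg_cong2[of _ _ _ _ "(+)"] emeasure_lborel_shift) auto
  also have "\<dots> = emeasure lborel (B \<inter> {t..<1} \<union> B \<inter> {0..<t})"
    by (intro plus_emeasure) auto
  also have "B \<inter> {t..<1} \<union> B \<inter> {0..<t} = B" using B1 t by auto
  also have "emeasure lborel B = emeasure circle_measure B"
    using B1 by (subst emeasure_restrict_space) auto
  finally show "emeasure (distr circle_measure circle_measure (\<lambda>x. frac (x + c))) B
      = emeasure circle_measure B" .
qed simp

section \<open>Functions on the circle and coboundaries with small support\<close>

definition periodic :: "(real \<Rightarrow> int) \<Rightarrow> bool" where
  "periodic g \<longleftrightarrow> g \<in> measurable borel (count_space UNIV) \<and> (\<forall>x l. g (x + of_int l) = g x)"

text \<open>The quantity for Borel-Cantelli: if it is summable along a sequence, almost every point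
  lies in only finitely many of the supports.\<close>

definition support_size :: "(real \<Rightarrow> int) \<Rightarrow> real" where
  "support_size g = measure circle_measure {x \<in> {0..<1}. g x \<noteq> 0}"

lemma periodicD: "periodic g \<Longrightarrow> g (x + of_int l) = g x"
  by (simp add: periodic_def)

lemma periodic_frac: "periodic g \<Longrightarrow> g (frac x) = g x"
  using periodicD[of g "frac x" "\<lfloor>x\<rfloor>"] by (simp add: frac_def)

lemma periodic_shift:
  assumes "periodic g" shows "periodic (\<lambda>x. g (x + c))"
proof -
  have [measurable]: "g \<in> measurable borel (count_space UNIV)" using assms by (simp add: periodic_def)
  have "g (x + of_int l + c) = g (x + c)" for x l
    using periodicD[OF assms, of "x + c" l] by (simp add: algebra_simps)
  then show ?thesis by (simp add: periodic_def)
qed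

lemma periodic_add: "periodic g \<Longrightarrow> periodic h \<Longrightarrow> periodic (\<lambda>x. g x + h x)"
  unfolding periodic_def by auto

lemma periodic_uminus: "periodic g \<Longrightarrow> periodic (\<lambda>x. - g x)"
  unfolding periodic_def by auto

lemma periodic_sum: "finite A \<Longrightarrow> (\<And>i. i \<in> A \<Longrightarrow> periodic (g i)) \<Longrightarrow> periodic (\<lambda>x. \<Sum>i\<in>A. g i x)"
  by (induction A rule: finite_induct) (auto intro: periodic_add, simp add: periodic_def)

lemma sets_support:
  assumes "periodic g"
  shows "{x \<in> {0..<1}. g x \<noteq> 0} \<in> sets circle_measure"
proof -
  have [measurable]: "g \<in> measurable borel (count_space UNIV)" using assms by (simp add: periodic_def)
  show ?thesis unfolding sets_circle_measure by auto
qed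

lemma support_size_shift:
  assumes "periodic g" shows "support_size (\<lambda>x. g (x + c)) = support_size g"
proof -
  have "support_size g
      = measure (distr circle_measure circle_measure (\<lambda>x. frac (x + c))) {x \<in> {0..<1}. g x \<noteq> 0}"
    by (simp add: support_size_def distr_rotation)
  also have "\<dots> = measure circle_measure ((\<lambda>x. frac (x + c)) -` {x \<in> {0..<1}. g x \<noteq> 0} \<inter> space circle_measure)"
    by (rule measure_distr[OF measurable_rotation sets_support[OF assms]])
  also have "(\<lambda>x. frac (x + c)) -` {x \<in> {0..<1}. g x \<noteq> 0} \<inter> space circle_measure
      = {x \<in> {0..<1}. g (x + c) \<noteq> 0}"
    by (auto simp: space_restrict_space periodic_frac[OF assms] frac_lt_1)
  finally show ?thesis by (simp add: support_size_def)
qed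

lemma support_size_uminus: "support_size (\<lambda>x. - g x) = support_size g"
  by (simp add: support_size_def)

lemma support_size_sum:
  assumes "finite A" "\<And>i. i \<in> A \<Longrightarrow> periodic (g i)"
  shows "support_size (\<lambda>x. \<Sum>i\<in>A. g i x) \<le> (\<Sum>i\<in>A. support_size (g i))"
proof -
  interpret prob_space circle_measure by (rule prob_space_circle_measure)
  have "support_size (\<lambda>x. \<Sum>i\<in>A. g i x) \<le> measure circle_measure (\<Union>i\<in>A. {x \<in> {0..<1}. g i x \<noteq> 0})"
    unfolding support_size_def using assms
    by (intro finite_measure_mono sets.finite_UN sets_support) (auto intro: sum.neutral)
  also have "\<dots> \<le> (\<Sum>i\<in>A. support_size (g i))"
    unfolding support_size_def using assms
    by (intro finite_measure_subadditive_finite image_subsetI sets_support) auto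
  finally show ?thesis .
qed

lemma support_size_add:
  assumes "periodic g" "periodic h"
  shows "support_size (\<lambda>x. g x + h x) \<le> support_size g + support_size h"
  using support_size_sum[of "{0, 1 :: nat}" "\<lambda>i. if i = 0 then g else h"] assms
  by simp

text \<open>The difference telescopes along \<open>|k|\<close> single rotation steps, so a signed
  sum of \<open>|k|\<close> translates of \<open>h\<close> is a transfer function; each translate
  has a support of the same measure.\<close>

lemma coboundary_of_translates:
  assumes h: "periodic h"
  obtains g where "periodic g" "support_size g \<le> real_of_int \<bar>k\<bar> * support_size h"
    "\<And>x. g (x + \<alpha>) - g x = h x - h (x - of_int k * \<alpha>)"
proof (cases "k \<ge> 0")
  case True
  then obtain n where n: "k = int n" by (metis nonneg_eq_int)
  \<comment> \<open>The indices run from 1 to \<open>n\<close>: passing to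
    \<open>x + \<alpha>\<close> gains the term at 0 and loses the one at \<open>n\<close>.\<close>
  define g where "g x = (\<Sum>j<n. h (x + - real (Suc j) * \<alpha>))" for x
  show thesis
  proof
    show "periodic g" unfolding g_def by (intro periodic_sum periodic_shift h) auto
    have "support_size g \<le> (\<Sum>j<n. support_size (\<lambda>x. h (x + - real (Suc j) * \<alpha>)))"
      unfolding g_def by (intro support_size_sum periodic_shift h) auto
    also have "\<dots> = (\<Sum>j<n. support_size h)"
      by (intro sum.cong refl support_size_shift h)
    finally show "support_size g \<le> real_of_int \<bar>k\<bar> * support_size h" by (simp add: n)
    have "g (x + \<alpha>) = (\<Sum>j<n. h (x - real j * \<alpha>))" for x
      unfolding g_def by (intro sum.cong refl arg_cong[of _ _ h]) (simp add: algebra_simps)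
    moreover have "g x = (\<Sum>j<n. h (x - real (Suc j) * \<alpha>))" for x
      by (simp only: g_def mult_minus_left add_uminus_conv_diff)
    ultimately have "g (x + \<alpha>) - g x = (\<Sum>j<n. h (x - real j * \<alpha>) - h (x - real (Suc j) * \<alpha>))" for x
      by (simp only: sum_subtractf)
    then show "g (x + \<alpha>) - g x = h x - h (x - of_int k * \<alpha>)" for x
      using sum_lessThan_telescope'[of "\<lambda>j. h (x - real j * \<alpha>)" n] by (simp only: n) simp
  qed
next
  case False
  define n where "n = nat (- k)"
  with False have n: "k = - int n" by simp
  \<comment> \<open>For negative \<open>k\<close> the telescoping runs the other way: the sum starts
    at 0 and carries a minus sign.\<close>
  define g where "g x = - (\<Sum>j<n. h (x + real j * \<alpha>))" for x
  show thesis
  proof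
    show "periodic g" unfolding g_def by (intro periodic_uminus periodic_sum periodic_shift h) auto
    have "support_size g \<le> (\<Sum>j<n. support_size (\<lambda>x. h (x + real j * \<alpha>)))"
      unfolding g_def support_size_uminus by (intro support_size_sum periodic_shift h) auto
    also have "\<dots> = (\<Sum>j<n. support_size h)"
      by (intro sum.cong refl support_size_shift h)
    finally show "support_size g \<le> real_of_int \<bar>k\<bar> * support_size h" by (simp add: n)
    have "g (x + \<alpha>) = - (\<Sum>j<n. h (x + real (Suc j) * \<alpha>))" for x
      unfolding g_def by (intro sum.cong refl arg_cong[of _ _ uminus] arg_cong[of _ _ h])
          (simp add: algebra_simps)
    then have "g (x + \<alpha>) - g x = - (\<Sum>j<n. h (x + real (Suc j) * \<alpha>) - h (x + real j * \<alpha>))" for x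
      by (simp add: g_def sum_subtractf)
    then show "g (x + \<alpha>) - g x = h x - h (x - of_int k * \<alpha>)" for x
      using sum_lessThan_telescope[of "\<lambda>j. h (x + real j * \<alpha>)" n] by (simp only: n) simp
  qed
qed

lemma periodic_floor_diff: "periodic (\<lambda>x. \<lfloor>x\<rfloor> - \<lfloor>x - e\<rfloor>)"
proof -
  have "x + of_int l - e = (x - e) + of_int l" for x l by simp
  then show ?thesis unfolding periodic_def by (simp only: floor_add_int) simp
qed

text \<open>On \<open>[0, 1)\<close> both floors vanish once \<open>x \<ge> e\<close>, so the
  support lies in \<open>[0, e)\<close>.\<close>

lemma support_size_floor_diff:
  assumes "0 \<le> e"
  shows "support_size (\<lambda>x. \<lfloor>x\<rfloor> - \<lfloor>x - e\<rfloor>) \<le> e"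
proof -
  have "{x \<in> {0..<1}. \<lfloor>x\<rfloor> - \<lfloor>x - e\<rfloor> \<noteq> 0} \<subseteq> {0..<e}"
  proof
    fix x :: real assume x: "x \<in> {x \<in> {0..<1}. \<lfloor>x\<rfloor> - \<lfloor>x - e\<rfloor> \<noteq> 0}"
    show "x \<in> {0..<e}"
    proof (rule ccontr)
      assume "x \<notin> {0..<e}"
      with x assms have "\<lfloor>x\<rfloor> = 0" "\<lfloor>x - e\<rfloor> = 0" by (auto simp: floor_eq_iff)
      with x show False by simp
    qed
  qed
  moreover have "{x \<in> {0..<1}. \<lfloor>x\<rfloor> - \<lfloor>x - e\<rfloor> \<noteq> 0} \<in> sets borel"
    using sets_support[OF periodic_floor_diff[of e]] by (simp only: sets_circle_measure)
  ultimately have "measure lborel {x \<in> {0..<1}. \<lfloor>x\<rfloor> - \<lfloor>x - e\<rfloor> \<noteq> 0} \<le> measure lborel {0..<e}"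
    by (intro measure_mono_fmeasurable) (auto simp: fmeasurable_def assms)
  then show ?thesis
    using assms unfolding support_size_def by (subst measure_restrict_space) auto
qed

lemma cocycle_move_coboundary:
  assumes u: "u = of_int l + of_int k * \<alpha>" and "0 \<le> e"
  obtains g where "periodic g" "support_size g \<le> real_of_int \<bar>k\<bar> * e"
    "\<And>x. g (x + \<alpha>) - g x = cocycle u (w + e) x - cocycle u w x"
proof -
  \<comment> \<open>For \<open>e \<le> 1\<close> this is the 1-periodic indicator of
    \<open>[w, w + e)\<close>.\<close>
  define h where "h x = \<lfloor>x + - w\<rfloor> - \<lfloor>x + - w - e\<rfloor>" for x
  have h: "periodic h" unfolding h_def by (rule periodic_shift[OF periodic_floor_diff])
  have "support_size h \<le> e"
    unfolding h_def using support_size_shift[OF periodic_floor_diff[of e], of "- w"]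
      support_size_floor_diff[OF \<open>0 \<le> e\<close>] by simp
  moreover obtain g where g: "periodic g" "support_size g \<le> real_of_int \<bar>k\<bar> * support_size h"
    "\<And>x. g (x + \<alpha>) - g x = h x - h (x - of_int k * \<alpha>)"
    using coboundary_of_translates[OF h, of k \<alpha>] by blast
  ultimately have "support_size g \<le> real_of_int \<bar>k\<bar> * e"
    by (meson abs_ge_zero mult_left_mono of_int_0_le_iff order_trans)
  moreover have "g (x + \<alpha>) - g x = cocycle u (w + e) x - cocycle u w x" for x
  proof -
    \<comment> \<open>The integer \<open>l\<close> by which \<open>u\<close> and
      \<open>k \<alpha>\<close> differ is absorbed by periodicity.\<close>
    have "h (x - of_int k * \<alpha>) = h (x - u)"
      using periodicD[OF h, of "x - u" l] by (simp add: u algebra_simps)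
    moreover have "h x - h (x - u) = cocycle u (w + e) x - cocycle u w x"
      unfolding h_def cocycle_def by (simp add: algebra_simps)
    ultimately show ?thesis by (simp add: g(3))
  qed
  ultimately show thesis using that g(1) by blast
qed

text \<open>The partial sums \<open>F n\<close> of the \<open>g n\<close> are transfer functions for
  \<open>\<Phi> n\<close>. By Borel-Cantelli they are eventually constant at almost every point, and
  the parity of the limit is a transfer function for \<open>\<Psi>\<close>.\<close>

lemma measurable_coboundary_limit:
  assumes g: "\<And>n. periodic (g n)" and sm: "summable (\<lambda>n. support_size (g n))"
    and cob: "\<And>n x. g n (x + \<alpha>) - g n x = \<Phi> (Suc n) x - \<Phi> n x"
    and zero: "\<And>x. \<Phi> 0 x = 0"
    and lim: "\<And>x. \<forall>\<^sub>F n in sequentially. \<Phi> n x = \<Psi> x"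
  obtains f :: "real \<Rightarrow> bit"
  where "f \<in> measurable circle_measure (count_space UNIV)"
    "AE x in circle_measure. f (frac (x + \<alpha>)) = f x + of_int (\<Psi> x)"
proof -
  define F where "F n x = (\<Sum>i<n. g i x)" for n x
  have F: "periodic (F n)" for n unfolding F_def by (intro periodic_sum g) auto
  have FPhi: "F n (x + \<alpha>) = F n x + \<Phi> n x" for n x
  proof (induction n)
    case (Suc n)
    then show ?case using cob[of n x] by (simp add: F_def)
  qed (simp add: F_def zero)
  \<comment> \<open>Eventual oddness is a countable Boolean combination of measurable conditions, so
    \<open>f\<close> is measurable; it takes the default value 0 where the parity of
    \<open>F n x\<close> does not stabilise.\<close>
  define f :: "real \<Rightarrow> bit" where "f x = (if \<exists>N. \<forall>n\<ge>N. odd (F n x) then 1 else 0)" for x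
  have f_eq: "f x = of_int c" if "\<forall>\<^sub>F n in sequentially. F n x = c" for x c
  proof (cases "odd c")
    case True
    with that have "\<exists>N. \<forall>n\<ge>N. odd (F n x)" by (auto simp: eventually_sequentially)
    with True show ?thesis by (auto simp: f_def elim!: oddE)
  next
    case False
    have "\<not> (\<exists>N. \<forall>n\<ge>N. odd (F n x))"
    proof
      assume "\<exists>N. \<forall>n\<ge>N. odd (F n x)"
      then have "\<forall>\<^sub>F n in sequentially. odd (F n x)" by (simp add: eventually_sequentially)
      with that have "\<forall>\<^sub>F n in sequentially. False"
        by eventually_elim (use False in simp)
      then show False by simp
    qed
    then have "f x = 0" unfolding f_def by (rule if_not_P)
    with False show ?thesis by (auto elim!: evenE)
  qed
  have [measurable]: "F n \<in> measurable borel (count_space UNIV)" for n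
    using F by (simp add: periodic_def)
  have "f \<in> measurable borel (count_space UNIV)" unfolding f_def by measurable
  then have "f \<in> measurable circle_measure (count_space UNIV)"
    by (intro measurable_restrict_space1) simp
  moreover have "AE x in circle_measure. f (frac (x + \<alpha>)) = f x + of_int (\<Psi> x)"
  proof -
    interpret prob_space circle_measure by (rule prob_space_circle_measure)
    have "AE x in circle_measure. \<forall>\<^sub>F n in sequentially. x \<in> space circle_measure - {x \<in> {0..<1}. g n x \<noteq> 0}"
      using sm by (intro borel_cantelli_AE1 sets_support g)
          (simp_all add: support_size_def emeasure_finite less_top[symmetric])
    then show ?thesis
    proof eventually_elim
      case (elim x)
      then obtain N where N: "\<And>n. n \<ge> N \<Longrightarrow> g n x = 0"
        by (auto simp: eventually_sequentially space_restrict_space)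
      have "F n x = F N x" if "n \<ge> N" for n
        using that by (induction n rule: dec_induct) (auto simp: F_def N)
      then have c: "\<forall>\<^sub>F n in sequentially. F n x = F N x"
        by (rule eventually_sequentiallyI)
      \<comment> \<open>No second exceptional set arises at \<open>frac (x + \<alpha>)\<close>:
        there \<open>F n\<close> equals \<open>F n x + \<Phi> n x\<close>, and both terms are
        eventually constant.\<close>
      have shift: "F n (frac (x + \<alpha>)) = F n x + \<Phi> n x" for n
        using FPhi[of n x] by (simp only: periodic_frac[OF F])
      have "\<forall>\<^sub>F n in sequentially. F n (frac (x + \<alpha>)) = F N x + \<Psi> x"
        using c lim[of x] by eventually_elim (simp add: shift)
      from f_eq[OF this] f_eq[OF c] show ?case by (simp only: of_int_add)
    qed
  qed
  ultimately show thesis using that by blast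
qed

section \<open>Borel sets of the phase space\<close>

lemma openin_phase_space_subset: "{U. openin phase_space U} \<subseteq> Pow ({0..<1} \<times> UNIV)"
  using openin_subset[of phase_space] by (auto simp: topspace_phase_space)

lemma space_borel_of_phase_space: "space (borel_of phase_space) = {0..<1} \<times> UNIV"
  unfolding borel_of_def topspace_phase_space by (rule space_measure_of[OF openin_phase_space_subset])

lemma open_in_sets_borel_of_phase_space: "openin phase_space U \<Longrightarrow> U \<in> sets (borel_of phase_space)"
  unfolding borel_of_def topspace_phase_space
  by (subst sets_measure_of[OF openin_phase_space_subset]) auto

text \<open>The fibre has two points, so \<open>A\<close> is a union of two pieces, each the
  \<open>fst\<close>-preimage of a slice cut down to the open set
  \<open>[0, 1) \<times> {i}\<close>.\<close>

lemma sets_borel_of_phase_space: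
  assumes "\<And>i. {x \<in> {0..<1}. (x, i) \<in> A} \<in> sets borel" and A: "A \<subseteq> {0..<1} \<times> UNIV"
  shows "A \<in> sets (borel_of phase_space)"
proof -
  let ?M = "borel_of phase_space"
  note sp = space_borel_of_phase_space
  have "fst \<in> measurable ?M (restrict_space borel {0..<1})"
  proof (intro measurable_restrict_space2 borel_measurableI)
    fix S :: "real set" assume "open S"
    have "fst -` S \<inter> space ?M = ({0..<1} \<inter> S) \<times> UNIV" unfolding sp by auto
    moreover have "openin phase_space (({0..<1} \<inter> S) \<times> UNIV)"
      using \<open>open S\<close> unfolding phase_space_def by (intro openin_prod_Times_iff[THEN iffD2]) auto
    ultimately show "fst -` S \<inter> space ?M \<in> sets ?M"
      by (simp add: open_in_sets_borel_of_phase_space)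
  qed (auto simp: sp)
  have slice: "({x \<in> {0..<1}. (x, i) \<in> A} \<times> UNIV) \<inter> ({0..<1} \<times> {i}) \<in> sets ?M" for i
  proof (rule sets.Int)
    have "{x \<in> {0..<1}. (x, i) \<in> A} \<in> sets (restrict_space borel {0..<1})"
      using assms(1)[of i] by (subst sets_restrict_space_iff) auto
    from measurable_sets[OF \<open>fst \<in> _\<close> this]
    have "fst -` {x \<in> {0..<1}. (x, i) \<in> A} \<inter> space ?M \<in> sets ?M" .
    also have "fst -` {x \<in> {0..<1}. (x, i) \<in> A} \<inter> space ?M = {x \<in> {0..<1}. (x, i) \<in> A} \<times> UNIV"
      unfolding sp by auto
    finally show "{x \<in> {0..<1}. (x, i) \<in> A} \<times> UNIV \<in> sets ?M" .
    have "openin phase_space ({0..<1} \<times> {i})"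
      unfolding phase_space_def by (intro openin_prod_Times_iff[THEN iffD2]) auto
    then show "{0..<1} \<times> {i} \<in> sets ?M"
      by (simp add: open_in_sets_borel_of_phase_space)
  qed
  have UB: "(UNIV :: bit set) = {0, 1}" by (auto intro: bit.exhaust)
  have "A = (\<Union>i\<in>{0, 1 :: bit}. ({x \<in> {0..<1}. (x, i) \<in> A} \<times> UNIV) \<inter> ({0..<1} \<times> {i}))"
    unfolding UB[symmetric] using A by auto
  also have "\<dots> \<in> sets ?M" by (intro sets.finite_UN slice) auto
  finally show ?thesis .
qed

lemma sets_slice_borel_of_phase_space:
  assumes "A \<in> sets (borel_of phase_space)"
  shows "{x \<in> {0..<1}. (x, i) \<in> A} \<in> sets borel"
proof -
  have "(\<lambda>x. (x, i)) \<in> measurable (restrict_space borel {0..<1}) (borel_of phase_space)"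
    unfolding borel_of_def topspace_phase_space
  proof (rule measurable_measure_of[OF openin_phase_space_subset])
    fix V assume "V \<in> {U. openin phase_space U}"
    then obtain W where W: "open W" "{x. (x, i) \<in> V} = {0..<1} \<inter> W"
      using openin_phase_space_slice[of V i] by (auto simp: openin_open)
    then have "(\<lambda>x. (x, i)) -` V \<inter> space (restrict_space borel {0..<1}) = {0..<1} \<inter> W"
      by (auto simp: space_restrict_space)
    then show "(\<lambda>x. (x, i)) -` V \<inter> space (restrict_space borel {0..<1})
        \<in> sets (restrict_space borel {0..<1})"
      using W(1) by (subst sets_restrict_space_iff) auto
  qed (auto simp: space_restrict_space)
  from measurable_sets[OF this assms] show ?thesis
    by (subst (asm) sets_restrict_space_iff) (auto simp: space_restrict_space vimage_def Int_def conj_commute)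
qed

lemma measurable_skew_product:
  assumes J: "J \<in> sets borel"
  shows "skew_product \<alpha> J \<in> measurable (borel_of phase_space) (borel_of phase_space)"
proof (rule measurableI)
  fix A assume A: "A \<in> sets (borel_of phase_space)"
  show "skew_product \<alpha> J -` A \<inter> space (borel_of phase_space) \<in> sets (borel_of phase_space)"
  proof (rule sets_borel_of_phase_space)
    fix i
    have rot: "{x. frac (x + \<alpha>) \<in> {y \<in> {0..<1}. (y, k) \<in> A}} \<in> sets borel" for k
    proof -
      have [measurable]: "{y \<in> {0..<1}. (y, k) \<in> A} \<in> sets borel"
        by (rule sets_slice_borel_of_phase_space[OF A])
      show ?thesis unfolding frac_def by measurable
    qed
    \<comment> \<open>The skew product flips the fibre on \<open>J\<close> and keeps it elsewhere,
      so a slice of the preimage is pieced together from rotated slices of \<open>A\<close>.\<close>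
    have "{x \<in> {0..<1}. (x, i) \<in> skew_product \<alpha> J -` A \<inter> space (borel_of phase_space)} =
      {0..<1} \<inter> ((J \<inter> {x. frac (x + \<alpha>) \<in> {y \<in> {0..<1}. (y, i + 1) \<in> A}})
        \<union> ({x. frac (x + \<alpha>) \<in> {y \<in> {0..<1}. (y, i) \<in> A}} - J))"
      by (auto simp: skew_product_def space_borel_of_phase_space frac_lt_1 indicator_def split: if_splits)
    also have "\<dots> \<in> sets borel" using J rot by (intro sets.Int sets.Un sets.Diff) auto
    finally show "{x \<in> {0..<1}. (x, i) \<in> skew_product \<alpha> J -` A \<inter> space (borel_of phase_space)}
        \<in> sets borel" .
  qed (auto simp: space_borel_of_phase_space)
qed (auto simp: space_borel_of_phase_space skew_product_def frac_lt_1)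

section \<open>Invariant measures carried by graphs\<close>

lemma measurable_graph:
  assumes f: "f \<in> measurable circle_measure (count_space UNIV)"
  shows "(\<lambda>x. (x, f x)) \<in> measurable circle_measure (borel_of phase_space)"
proof (rule measurableI)
  fix A assume A: "A \<in> sets (borel_of phase_space)"
  have UB: "(UNIV :: bit set) = {0, 1}" by (auto intro: bit.exhaust)
  have "(\<lambda>x. (x, f x)) -` A \<inter> space circle_measure =
    (\<Union>i\<in>{0, 1}. {x \<in> {0..<1}. (x, i) \<in> A} \<inter> (f -` {i} \<inter> space circle_measure))"
    unfolding UB[symmetric] by (auto simp: space_restrict_space)
  also have "\<dots> \<in> sets circle_measure"
  proof (rule sets.finite_UN)
    fix i
    have "{x \<in> {0..<1}. (x, i) \<in> A} \<in> sets circle_measure"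
      using sets_slice_borel_of_phase_space[OF A] unfolding sets_circle_measure by auto
    then show "{x \<in> {0..<1}. (x, i) \<in> A} \<inter> (f -` {i} \<inter> space circle_measure) \<in> sets circle_measure"
      by (rule sets.Int) (rule measurable_sets[OF f], simp)
  qed simp
  finally show "(\<lambda>x. (x, f x)) -` A \<inter> space circle_measure \<in> sets circle_measure" .
qed (auto simp: space_borel_of_phase_space space_restrict_space)

text \<open>The transfer equation says that the graph map intertwines the rotation with
  \<open>skew_product \<alpha> J\<close> almost everywhere, so it carries the rotation-invariant
  Lebesgue measure to an invariant measure.\<close>

lemma invariant_prob_graph:
  assumes J: "J \<in> sets borel"
    and f: "f \<in> measurable circle_measure (count_space UNIV)"
    and cob: "AE x in circle_measure. f (frac (x + \<alpha>)) = f x + indicator J x"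
  shows "invariant_prob phase_space (skew_product \<alpha> J)
    (distr circle_measure (borel_of phase_space) (\<lambda>x. (x, f x)))" (is "invariant_prob _ ?T ?\<mu>")
  unfolding invariant_prob_def
proof (intro conjI)
  interpret prob_space circle_measure by (rule prob_space_circle_measure)
  note graph = measurable_graph[OF f]
  note T = measurable_skew_product[OF J, of \<alpha>]
  show "sets ?\<mu> = sets (borel_of phase_space)" by simp
  show "prob_space ?\<mu>" by (rule prob_space_distr[OF graph])
  show "?T \<in> measurable ?\<mu> ?\<mu>" using T by simp
  have "distr ?\<mu> ?\<mu> ?T = distr ?\<mu> (borel_of phase_space) ?T"
    by (intro distr_cong) auto
  also have "\<dots> = distr circle_measure (borel_of phase_space) (?T \<circ> (\<lambda>x. (x, f x)))"
    by (rule distr_distr[OF T graph])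
  also have "\<dots> = distr circle_measure (borel_of phase_space) ((\<lambda>x. (x, f x)) \<circ> (\<lambda>x. frac (x + \<alpha>)))"
  proof (rule distr_cong_AE)
    show "AE x in circle_measure. (?T \<circ> (\<lambda>x. (x, f x))) x = ((\<lambda>x. (x, f x)) \<circ> (\<lambda>x. frac (x + \<alpha>))) x"
      using cob by eventually_elim (simp add: skew_product_def)
  qed (use measurable_comp[OF graph T] measurable_comp[OF measurable_rotation graph] in auto)
  also have "\<dots> = distr (distr circle_measure circle_measure (\<lambda>x. frac (x + \<alpha>))) (borel_of phase_space) (\<lambda>x. (x, f x))"
    by (rule distr_distr[OF graph measurable_rotation, symmetric])
  also have "\<dots> = ?\<mu>" by (simp only: distr_rotation)
  finally show "distr ?\<mu> ?\<mu> ?T = ?\<mu>" .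
qed

text \<open>A measurable transfer function of the cocycle yields two invariant measures, carried by
  its graph and by the complement of its graph.\<close>

lemma not_uniquely_ergodic_if_coboundary:
  fixes f :: "real \<Rightarrow> bit"
  assumes J: "J \<in> sets borel"
    and f: "f \<in> measurable circle_measure (count_space UNIV)"
    and cob: "AE x in circle_measure. f (frac (x + \<alpha>)) = f x + indicator J x"
  shows "\<not> uniquely_ergodic phase_space (skew_product \<alpha> J)"
proof
  interpret prob_space circle_measure by (rule prob_space_circle_measure)
  \<comment> \<open>Adding a constant preserves the transfer equation.\<close>
  define f' where "f' x = f x + 1" for x
  have f': "f' \<in> measurable circle_measure (count_space UNIV)"
    using measurable_compose[OF f, of "\<lambda>i. i + 1" "count_space UNIV"] by (simp add: f'_def[abs_def])
  have "AE x in circle_measure. f' (frac (x + \<alpha>)) = f' x + indicator J x"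
    using cob by eventually_elim (simp only: f'_def add.assoc add.commute[of 1])
  note inv = invariant_prob_graph[OF J f cob] invariant_prob_graph[OF J f' this]
  assume "uniquely_ergodic phase_space (skew_product \<alpha> J)"
  with inv have eq: "distr circle_measure (borel_of phase_space) (\<lambda>x. (x, f x)) =
      distr circle_measure (borel_of phase_space) (\<lambda>x. (x, f' x))"
    unfolding uniquely_ergodic_def by blast
  define G where "G = {(x, f x) |x. x \<in> {0..<1 :: real}}"
  have G: "G \<in> sets (borel_of phase_space)"
  proof (rule sets_borel_of_phase_space)
    fix i
    have "{x \<in> {0..<1}. (x, i) \<in> G} = f -` {i} \<inter> space circle_measure"
      by (auto simp: G_def space_restrict_space)
    then show "{x \<in> {0..<1}. (x, i) \<in> G} \<in> sets borel"
      using measurable_sets[OF f, of "{i}"] by (simp add: sets_circle_measure)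
  qed (auto simp: G_def)
  have "emeasure (distr circle_measure (borel_of phase_space) (\<lambda>x. (x, f x))) G
      = emeasure circle_measure (space circle_measure)"
    by (subst emeasure_distr[OF measurable_graph[OF f] G], rule arg_cong[of _ _ "emeasure circle_measure"])
      (auto simp: G_def space_restrict_space)
  moreover have "emeasure (distr circle_measure (borel_of phase_space) (\<lambda>x. (x, f' x))) G
      = emeasure circle_measure {}"
    by (subst emeasure_distr[OF measurable_graph[OF f'] G], rule arg_cong[of _ _ "emeasure circle_measure"])
      (auto simp: G_def f'_def)
  ultimately show False using emeasure_space_1 eq by simp
qed

section \<open>Arithmetic of the quadratic field\<close>

lemma Ints_nonempty: "(\<int> :: real set) \<noteq> {}"
  using Ints_0 by blast

definition silver :: real where "silver = sqrt 2 - 1"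

text \<open>The Galois conjugate of \<open>silver\<close>, obtained from
  \<open>sqrt 2 \<mapsto> - sqrt 2\<close>; the product of the two is -1.\<close>

definition silver_conj :: real where "silver_conj = - 1 - sqrt 2"

lemma sqrt_2_bounds: "141 / 100 \<le> sqrt 2" "sqrt 2 \<le> 142 / 100"
  by (rule real_le_rsqrt real_le_lsqrt; simp add: power2_eq_square)+

lemma silver_bounds: "41 / 100 \<le> silver" "silver \<le> 42 / 100"
  using sqrt_2_bounds by (auto simp: silver_def)

lemma silver_square: "silver * silver = 1 - 2 * silver"
  "silver_conj * silver_conj = 1 - 2 * silver_conj"
  by (simp_all add: silver_def silver_conj_def algebra_simps)

lemma silver_conj_eq: "silver_conj = - (1 / silver)"
  using silver_bounds by (simp add: field_simps) (simp add: silver_def silver_conj_def algebra_simps)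

lemma silver_irrational: "silver \<notin> \<rat>"
proof
  assume "silver \<in> \<rat>"
  then have "silver + 1 \<in> \<rat>" by (intro Rats_add) auto
  then have "sqrt 2 \<in> \<rat>" by (simp add: silver_def)
  then obtain m n :: nat where n: "n \<noteq> 0" "\<bar>sqrt 2\<bar> = real m / real n" "coprime m n"
    by (rule Rats_abs_nat_div_natE)
  then have "(real m)\<^sup>2 = (sqrt 2)\<^sup>2 * (real n)\<^sup>2"
    by (simp add: power_divide)
  then have "real (m\<^sup>2) = real (2 * n\<^sup>2)" by simp
  then have eq: "m\<^sup>2 = 2 * n\<^sup>2" by (simp only: of_nat_eq_iff)
  then have "even (m\<^sup>2)" by simp
  then have "even m" by simp
  then obtain j where "m = 2 * j" by (elim evenE)
  with eq have "n\<^sup>2 = 2 * j\<^sup>2" by (simp add: power2_eq_square)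
  then have "even (n\<^sup>2)" by simp
  with \<open>even m\<close> have "2 dvd m" "2 dvd n" by simp_all
  with n(3) have "2 dvd (1 :: nat)" by (rule coprime_common_divisor)
  then show False by simp
qed

text \<open>\<open>x\<close> is an element of the ring of integers of the field generated by
  \<open>sqrt 2\<close>, and \<open>y\<close> is its Galois conjugate. As a relation this needs no
  choice of the coefficients.\<close>

definition conjugates :: "real \<Rightarrow> real \<Rightarrow> bool" where
  "conjugates x y \<longleftrightarrow> (\<exists>a b :: int. x = of_int a + of_int b * silver \<and>
     y = of_int a + of_int b * silver_conj)"

lemma conjugatesI:
  "x = of_int a + of_int b * silver \<Longrightarrow> y = of_int a + of_int b * silver_conj \<Longrightarrow> conjugates x y"
  unfolding conjugates_def by blast

lemma conjugates_of_int: "conjugates (of_int a) (of_int a)"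
  by (rule conjugatesI[of _ a 0]) auto

lemma conjugates_silver: "conjugates silver silver_conj"
  by (rule conjugatesI[of _ 0 1]) auto

lemma conjugates_diff: "conjugates x y \<Longrightarrow> conjugates x' y' \<Longrightarrow> conjugates (x - x') (y - y')"
proof -
  assume "conjugates x y" "conjugates x' y'"
  then obtain a b a' b' where
    "x = of_int a + of_int b * silver" "y = of_int a + of_int b * silver_conj"
    "x' = of_int a' + of_int b' * silver" "y' = of_int a' + of_int b' * silver_conj"
    unfolding conjugates_def by blast
  then show ?thesis by (intro conjugatesI[of _ "a - a'" "b - b'"]) (simp_all add: algebra_simps)
qed

lemma conjugates_add: "conjugates x y \<Longrightarrow> conjugates x' y' \<Longrightarrow> conjugates (x + x') (y + y')"
  using conjugates_diff[of x y "0 - x'" "0 - y'"]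
    conjugates_diff[of 0 0 x' y'] conjugates_of_int[of 0] by simp

lemma conjugates_mult: "conjugates x y \<Longrightarrow> conjugates x' y' \<Longrightarrow> conjugates (x * x') (y * y')"
proof -
  assume "conjugates x y" "conjugates x' y'"
  then obtain a b a' b' where
    "x = of_int a + of_int b * silver" "y = of_int a + of_int b * silver_conj"
    "x' = of_int a' + of_int b' * silver" "y' = of_int a' + of_int b' * silver_conj"
    unfolding conjugates_def by blast
  \<comment> \<open>Only the quadratic equation of \<open>s\<close> enters, so the same coefficients
    serve \<open>silver\<close> and \<open>silver_conj\<close>.\<close>
  moreover have "(a1 + b1 * s) * (a2 + b2 * s)
      = (a1 * a2 + b1 * b2) + (a1 * b2 + b1 * a2 - 2 * (b1 * b2)) * s"
    if "s * s = 1 - 2 * s" for a1 b1 a2 b2 s :: real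
  proof -
    have "(a1 + b1 * s) * (a2 + b2 * s) = a1 * a2 + (a1 * b2 + b1 * a2) * s + b1 * b2 * (s * s)"
      by (simp add: algebra_simps)
    then show ?thesis unfolding that by (simp add: algebra_simps)
  qed
  ultimately show ?thesis
    by (intro conjugatesI[of _ "a * a' + b * b'" "a * b' + b * a' - 2 * (b * b')"])
        (simp_all add: silver_square)
qed

lemma conjugates_power: "conjugates x y \<Longrightarrow> conjugates (x ^ n) (y ^ n)"
  using conjugates_of_int[of 1] by (induction n) (auto intro: conjugates_mult)

lemma conjugates_sum:
  "finite A \<Longrightarrow> (\<And>i. i \<in> A \<Longrightarrow> conjugates (f i) (g i)) \<Longrightarrow> conjugates (sum f A) (sum g A)"
  by (induction A rule: finite_induct) (use conjugates_of_int[of 0] in \<open>auto intro: conjugates_add\<close>)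

text \<open>The product is the norm \<open>a^2 - 2 a b - b^2\<close>, an integer, and irrationality
  of \<open>silver\<close> makes it nonzero.\<close>

lemma conjugates_norm_ge_1:
  assumes "conjugates x y" "x \<noteq> 0"
  shows "1 \<le> \<bar>x\<bar> * \<bar>y\<bar>"
proof -
  obtain a b where x: "x = of_int a + of_int b * silver"
    and y: "y = of_int a + of_int b * silver_conj"
    using assms(1) unfolding conjugates_def by blast
  have "x * y = of_int (a * a - 2 * a * b - b * b)"
    unfolding x y silver_def silver_conj_def by (simp add: algebra_simps)
  moreover have "x * y \<noteq> 0"
  proof
    assume "x * y = 0"
    with assms(2) have "y = 0" by simp
    then have *: "of_int a - of_int b * 2 - of_int b * silver = (0 :: real)"
      by (simp add: y silver_def silver_conj_def algebra_simps)
    show False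
    proof (cases "b = 0")
      case True
      with * x assms(2) show False by simp
    next
      case False
      with * have "silver = (of_int a - of_int b * 2) / of_int b" by (simp add: field_simps)
      also have "\<dots> \<in> \<rat>" by (intro Rats_divide Rats_diff Rats_mult) auto
      finally show False using silver_irrational by simp
    qed
  qed
  ultimately have "1 \<le> \<bar>x * y\<bar>" by (simp del: of_int_diff of_int_mult flip: of_int_abs)
  then show ?thesis by (simp add: abs_mult)
qed

text \<open>Since \<open>x - y = 2 b sqrt 2\<close>, estimates for an element and its conjugate
  control \<open>b\<close>, the factor that enters the support bound of
  \<open>cocycle_move_coboundary\<close>.\<close>

lemma conjugates_coefficient_bound:
  assumes "conjugates x y"
  obtains a b :: int where "x = of_int a + of_int b * silver" "of_int \<bar>b\<bar> \<le> \<bar>x\<bar> + \<bar>y\<bar>"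
proof -
  obtain a b where x: "x = of_int a + of_int b * silver"
    and y: "y = of_int a + of_int b * silver_conj"
    using assms unfolding conjugates_def by blast
  have "x - y = of_int b * (2 * sqrt 2)"
    by (simp add: x y silver_def silver_conj_def algebra_simps)
  then have "\<bar>of_int b\<bar> * (2 * sqrt 2) \<le> \<bar>x\<bar> + \<bar>y\<bar>"
    using abs_triangle_ineq4[of x y] by (simp add: abs_mult)
  moreover have "\<bar>real_of_int b\<bar> * 1 \<le> \<bar>real_of_int b\<bar> * (2 * sqrt 2)"
    using sqrt_2_bounds by (intro mult_left_mono) auto
  ultimately show thesis using x by (intro that[of a b]) auto
qed

text \<open>The numbers \<open>n silver - m\<close> and their conjugates differ by
  \<open>2 n sqrt 2 \<le> 3 n\<close>. If the former is below 1 in modulus, the conjugate is at most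
  \<open>4 n\<close>, and the norm bound gives a distance of at least
  \<open>1 / (4 n)\<close>.\<close>

lemma badly_approximable_silver: "badly_approximable silver"
proof -
  have bd: "1 / 4 \<le> real n * infdist (real n * silver) \<int>" if "n \<ge> 1" for n
  proof -
    have "1 / (4 * real n) \<le> infdist (real n * silver) \<int>"
      unfolding infdist_notempty[OF Ints_nonempty]
    proof (rule cINF_greatest)
      fix z :: real assume "z \<in> \<int>"
      then obtain m where z: "z = of_int m" by (auto elim: Ints_cases)
      define x where "x = real n * silver - of_int m"
      define y where "y = real n * silver_conj - of_int m"
      have xy: "conjugates x y"
        unfolding x_def y_def by (rule conjugatesI[of _ "- m" "int n"]) auto
      have "x \<noteq> 0"
      proof
        assume "x = 0"
        then have "silver = of_int m / of_int (int n)" using that by (simp add: x_def field_simps)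
        also have "\<dots> \<in> \<rat>" by (intro Rats_divide Rats_of_int)
        finally show False using silver_irrational by contradiction
      qed
      have "1 / (4 * real n) \<le> \<bar>x\<bar>"
      proof (cases "\<bar>x\<bar> \<ge> 1")
        case True
        have "1 / (4 * real n) \<le> 1" using that by simp
        with True show ?thesis by linarith
      next
        case False
        have "x - y = real n * (2 * sqrt 2)"
          by (simp add: x_def y_def silver_def silver_conj_def algebra_simps)
        moreover have "real n * (2 * sqrt 2) \<le> real n * 3"
          using sqrt_2_bounds by (intro mult_left_mono) auto
        moreover have "0 \<le> real n * (2 * sqrt 2)" by simp
        ultimately have "\<bar>y\<bar> \<le> 4 * real n" using False that by linarith
        have "1 \<le> \<bar>x\<bar> * \<bar>y\<bar>" by (rule conjugates_norm_ge_1[OF xy \<open>x \<noteq> 0\<close>])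
        also have "\<dots> \<le> \<bar>x\<bar> * (4 * real n)" using \<open>\<bar>y\<bar> \<le> _\<close> by (intro mult_left_mono) auto
        finally show ?thesis using that by (simp add: divide_le_eq)
      qed
      then show "1 / (4 * real n) \<le> dist (real n * silver) z"
        by (simp add: x_def z dist_real_def)
    qed auto
    then have "real n * (1 / (4 * real n)) \<le> real n * infdist (real n * silver) \<int>"
      by (intro mult_left_mono) auto
    with that show ?thesis by simp
  qed
  have "ereal (1 / 4) \<le> liminf (\<lambda>n. ereal (real n * infdist (real n * silver) \<int>))"
  proof (intro Liminf_bounded eventually_sequentiallyI[of 1])
    fix n :: nat assume "1 \<le> n"
    then show "ereal (1 / 4) \<le> ereal (real n * infdist (real n * silver) \<int>)"
      unfolding ereal_less_eq by (rule bd)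
  qed
  moreover have "(0 :: ereal) < ereal (1 / 4)" by simp
  ultimately show ?thesis
    unfolding badly_approximable_def using silver_irrational by (metis less_le_trans)
qed

section \<open>Lacunary sums\<close>

definition lacunary_sum :: "(nat \<Rightarrow> nat) \<Rightarrow> real" where
  "lacunary_sum r = (\<Sum>j. silver ^ r j)"

definition lacunary_partial :: "(nat \<Rightarrow> nat) \<Rightarrow> nat \<Rightarrow> real" where
  "lacunary_partial r n = (\<Sum>j<n. silver ^ r j)"

definition lacunary_partial_conj :: "(nat \<Rightarrow> nat) \<Rightarrow> nat \<Rightarrow> real" where
  "lacunary_partial_conj r n = (\<Sum>j<n. silver_conj ^ r j)"

text \<open>Gaps that grow with \<open>n\<close> make the remainder smaller than the reciprocal of
  the conjugate partial sum by a factor of order \<open>silver ^ n\<close>, which tends to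
  0.\<close>

definition lacunary :: "(nat \<Rightarrow> nat) \<Rightarrow> bool" where
  "lacunary r \<longleftrightarrow> (\<forall>n. r n + n < r (Suc n))"

lemma conjugates_lacunary_partial: "conjugates (lacunary_partial r n) (lacunary_partial_conj r n)"
  unfolding lacunary_partial_def lacunary_partial_conj_def
  by (intro conjugates_sum conjugates_power conjugates_silver) auto

lemma lacunary_shift_ge: "lacunary r \<Longrightarrow> r n + j \<le> r (j + n)"
proof (induction j)
  case (Suc j)
  then have "r (j + n) + (j + n) < r (Suc (j + n))" unfolding lacunary_def by blast
  with Suc show ?case by simp
qed simp

lemma silver_power_le: "m \<le> n \<Longrightarrow> silver ^ n \<le> silver ^ m"
  using silver_bounds by (intro power_decreasing) auto

lemma lacunary_summable:
  assumes "lacunary r" shows "summable (\<lambda>j. silver ^ r j)"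
proof (rule summable_comparison_test')
  show "summable (\<lambda>j. silver ^ j)" using silver_bounds by (intro summable_geometric) auto
  show "norm (silver ^ r j) \<le> silver ^ j" if "j \<ge> 0" for j
    using silver_bounds silver_power_le[of j "r j"] lacunary_shift_ge[OF assms, of 0 j] by simp
qed

text \<open>Comparison with a geometric series, where \<open>1 / (1 - silver) \<le> 2\<close>.
  Positivity makes the remainder nonzero, as the norm argument requires.\<close>

lemma lacunary_tail:
  assumes "lacunary r"
  shows "0 < lacunary_sum r - lacunary_partial r n"
    "lacunary_sum r - lacunary_partial r n \<le> 2 * silver ^ r n"
proof -
  have eq: "lacunary_sum r - lacunary_partial r n = (\<Sum>j. silver ^ r (j + n))"
    unfolding lacunary_sum_def lacunary_partial_def
    using suminf_minus_initial_segment[OF lacunary_summable[OF assms], of n] by simp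
  have sm: "summable (\<lambda>j. silver ^ r (j + n))"
    using lacunary_summable[OF assms] by (rule summable_ignore_initial_segment)
  show "0 < lacunary_sum r - lacunary_partial r n"
    unfolding eq using silver_bounds by (intro suminf_pos sm) auto
  have geo: "summable (\<lambda>j. silver ^ j)" using silver_bounds by (intro summable_geometric) auto
  have "(\<Sum>j. silver ^ r (j + n)) \<le> (\<Sum>j. silver ^ r n * silver ^ j)"
    using lacunary_shift_ge[OF assms] silver_power_le
    by (intro suminf_le sm summable_mult geo) (simp flip: power_add)
  also have "\<dots> = silver ^ r n * (1 / (1 - silver))"
    using silver_bounds by (subst suminf_mult[OF geo]) (simp add: suminf_geometric)
  also have "\<dots> \<le> silver ^ r n * 2"
    using silver_bounds by (intro mult_left_mono) (auto simp: divide_le_eq)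
  finally show "lacunary_sum r - lacunary_partial r n \<le> 2 * silver ^ r n"
    unfolding eq by simp
qed

lemma lacunary_partial_tendsto: "lacunary r \<Longrightarrow> lacunary_partial r \<longlonglongrightarrow> lacunary_sum r"
  unfolding lacunary_partial_def[abs_def] lacunary_sum_def
  by (intro summable_LIMSEQ lacunary_summable)

lemma lacunary_partial_nonneg: "0 \<le> lacunary_partial r n"
  unfolding lacunary_partial_def using silver_bounds by (intro sum_nonneg) auto

text \<open>Conjugate powers have modulus \<open>1 / silver ^ r j\<close>, so the last one
  dominates: scaled by \<open>silver ^ r n\<close> it contributes 1, and because
  \<open>silver \<le> 1 / 2\<close> the earlier ones contribute at most 1 by induction.\<close>

lemma lacunary_partial_conj_bound:
  assumes "lacunary r"
  shows "\<bar>lacunary_partial_conj r (Suc n)\<bar> * silver ^ r n \<le> 2"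
proof (induction n)
  case 0
  have "\<bar>silver_conj ^ r 0\<bar> * silver ^ r 0 = 1"
    using silver_bounds by (simp add: silver_conj_eq power_abs[symmetric] power_one_over)
  then show ?case by (simp add: lacunary_partial_conj_def)
next
  case (Suc n)
  have one: "\<bar>silver_conj ^ r (Suc n)\<bar> * silver ^ r (Suc n) = 1"
    using silver_bounds by (simp add: silver_conj_eq power_abs[symmetric] power_one_over)
  have "r n + 1 \<le> r (Suc n)" using lacunary_shift_ge[OF assms, of n 1] by simp
  then have "silver ^ r (Suc n) \<le> silver ^ r n * silver"
    using silver_power_le[of "r n + 1" "r (Suc n)"] by (simp add: mult.commute)
  also have "\<dots> \<le> silver ^ r n * (1 / 2)" using silver_bounds by (intro mult_left_mono) auto
  finally have "\<bar>lacunary_partial_conj r (Suc n)\<bar> * silver ^ r (Suc n)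
      \<le> \<bar>lacunary_partial_conj r (Suc n)\<bar> * (silver ^ r n * (1 / 2))"
    by (intro mult_left_mono) auto
  also have "\<dots> \<le> 1" using Suc by simp
  finally have "(\<bar>lacunary_partial_conj r (Suc n)\<bar> + \<bar>silver_conj ^ r (Suc n)\<bar>) * silver ^ r (Suc n) \<le> 2"
    using one by (simp add: distrib_right)
  moreover have "\<bar>lacunary_partial_conj r (Suc (Suc n))\<bar>
      \<le> \<bar>lacunary_partial_conj r (Suc n)\<bar> + \<bar>silver_conj ^ r (Suc n)\<bar>"
    unfolding lacunary_partial_conj_def sum.lessThan_Suc[of _ "Suc n"] by (rule abs_triangle_ineq)
  then have "\<bar>lacunary_partial_conj r (Suc (Suc n))\<bar> * silver ^ r (Suc n)
      \<le> (\<bar>lacunary_partial_conj r (Suc n)\<bar> + \<bar>silver_conj ^ r (Suc n)\<bar>) * silver ^ r (Suc n)"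
    using silver_bounds by (intro mult_right_mono) auto
  ultimately show ?case by linarith
qed

text \<open>A Liouville-type argument: the remainder after the partial sum is so small that the product
  with its conjugate, a nonzero integer, would be less than \<open>1\<close>.\<close>

lemma lacunary_sum_notin_int_span:
  assumes r: "lacunary r"
  shows "lacunary_sum r \<notin> int_span silver"
proof
  assume "lacunary_sum r \<in> int_span silver"
  then obtain a b where ab: "lacunary_sum r = of_int a + of_int b * silver"
    unfolding int_span_def by blast
  define y where "y = of_int a + of_int b * silver_conj"
  have xy: "conjugates (lacunary_sum r) y" by (rule conjugatesI[OF ab y_def])
  have bound: "1 \<le> 2 * (\<bar>y\<bar> + 2) * silver ^ n" for n
  proof -
    let ?P = "lacunary_partial_conj r (Suc n)"
    have "1 \<le> \<bar>lacunary_sum r - lacunary_partial r (Suc n)\<bar> * \<bar>y - ?P\<bar>"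
      using lacunary_tail(1)[OF r, of "Suc n"]
      by (intro conjugates_norm_ge_1 conjugates_diff xy conjugates_lacunary_partial) auto
    also have "\<dots> \<le> (2 * silver ^ r (Suc n)) * (\<bar>y\<bar> + \<bar>?P\<bar>)"
      using lacunary_tail[OF r, of "Suc n"] by (intro mult_mono) auto
    \<comment> \<open>The factor \<open>silver ^ r n\<close> will cancel the size of the conjugate,
      and \<open>silver ^ n\<close> remains.\<close>
    also have "\<dots> \<le> (2 * (silver ^ r n * silver ^ n)) * (\<bar>y\<bar> + \<bar>?P\<bar>)"
      using r silver_power_le[of "r n + n" "r (Suc n)"]
      by (intro mult_right_mono mult_left_mono) (auto simp: lacunary_def power_add less_imp_le)
    also have "\<dots> = 2 * (\<bar>y\<bar> * silver ^ r n + \<bar>?P\<bar> * silver ^ r n) * silver ^ n"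
      by (simp add: algebra_simps)
    also have "\<dots> \<le> 2 * (\<bar>y\<bar> * 1 + 2) * silver ^ n"
      using silver_bounds lacunary_partial_conj_bound[OF r, of n]
      by (intro mult_right_mono mult_left_mono add_mono) (auto simp: power_le_one)
    finally show ?thesis by simp
  qed
  have "(\<lambda>n. 2 * (\<bar>y\<bar> + 2) * silver ^ n) \<longlonglongrightarrow> 2 * (\<bar>y\<bar> + 2) * 0"
    using silver_bounds by (intro tendsto_mult tendsto_const LIMSEQ_realpow_zero) auto
  then have "1 \<le> 2 * (\<bar>y\<bar> + 2) * (0 :: real)"
    by (rule LIMSEQ_le_const) (use bound in blast)
  then show False by simp
qed

text \<open>The powers of 2 with even and with odd index. In the interlaced order each exponent is
  twice the previous one, which is the increment priced in \<open>lacunary_cost\<close>.\<close>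

definition even_exp :: "nat \<Rightarrow> nat" where "even_exp n = 4 ^ n"
definition odd_exp :: "nat \<Rightarrow> nat" where "odd_exp n = 2 * 4 ^ n"

lemma lacunary_exps: "lacunary even_exp" "lacunary odd_exp" "lacunary ((^) 2)"
proof -
  have lt: "n < 2 ^ n" "n < 4 ^ n" for n :: nat by (simp_all add: power_gt_expt)
  have "n < 3 * 4 ^ n" "n < 6 * 4 ^ n" for n :: nat
    using lt(2)[of n] by linarith+
  with lt(1) show "lacunary even_exp" "lacunary odd_exp" "lacunary ((^) 2)"
    unfolding lacunary_def even_exp_def odd_exp_def by simp_all
qed

text \<open>The two exponent sequences interleave to all powers of 2, so \<open>u + w\<close> is a
  lacunary sum as well and \<open>lacunary_sum_notin_int_span\<close> applies to it.\<close>

lemma lacunary_sum_even_odd: "lacunary_sum odd_exp + lacunary_sum even_exp = lacunary_sum ((^) 2)"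
proof -
  have pow: "(4 :: nat) ^ n = 2 ^ (2 * n)" for n by (simp add: power_mult)
  have "lacunary_partial odd_exp n + lacunary_partial even_exp n
      = lacunary_partial ((^) 2) (2 * n)" for n
    by (induction n) (simp_all add: lacunary_partial_def even_exp_def odd_exp_def pow)
  moreover have "(\<lambda>n. lacunary_partial odd_exp n + lacunary_partial even_exp n)
      \<longlonglongrightarrow> lacunary_sum odd_exp + lacunary_sum even_exp"
    by (intro tendsto_add lacunary_partial_tendsto lacunary_exps)
  moreover have "(\<lambda>n. lacunary_partial ((^) 2) (2 * n)) \<longlonglongrightarrow> lacunary_sum ((^) 2)"
    using LIMSEQ_subseq_LIMSEQ[OF lacunary_partial_tendsto[OF lacunary_exps(3)], of "\<lambda>n. 2 * n"]
    by (simp add: strict_mono_def o_def)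
  ultimately show ?thesis using LIMSEQ_unique by simp
qed

text \<open>The even sum exceeds its first term \<open>silver \<ge> 0.41\<close> and is at most 0.5;
  the odd sum is at most \<open>2 * silver ^ 2 < 0.36\<close>.\<close>

lemma lacunary_sum_bounds:
  "0 < lacunary_sum odd_exp" "lacunary_sum odd_exp \<le> lacunary_sum even_exp"
  "lacunary_sum odd_exp + lacunary_sum even_exp < 1"
proof -
  have "silver ^ 2 \<le> (42 / 100) ^ 2" using silver_bounds by (intro power_mono) auto
  then have s2: "silver ^ 2 \<le> 1764 / 10000" by (simp add: power2_eq_square)
  have "silver ^ 4 \<le> (42 / 100) ^ 4" using silver_bounds by (intro power_mono) auto
  then have s4: "silver ^ 4 \<le> 4 / 100" by (simp add: power4_eq_xxxx)
  have o: "0 < lacunary_sum odd_exp" "lacunary_sum odd_exp \<le> 2 * silver ^ 2"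
    using lacunary_tail[OF lacunary_exps(2), of 0] by (simp_all add: lacunary_partial_def odd_exp_def)
  have e: "silver < lacunary_sum even_exp" "lacunary_sum even_exp \<le> silver + 2 * silver ^ 4"
    using lacunary_tail[OF lacunary_exps(1), of 1]
    by (simp_all add: lacunary_partial_def even_exp_def)
  show "0 < lacunary_sum odd_exp" "lacunary_sum odd_exp \<le> lacunary_sum even_exp"
    "lacunary_sum odd_exp + lacunary_sum even_exp < 1"
    using o e s2 s4 silver_bounds by linarith+
qed

section \<open>Convergence of the cocycles and cost of each stage\<close>

lemma eventually_floor_diff_incseq:
  fixes s :: real
  assumes "\<And>n. S n \<le> s" "S \<longlonglongrightarrow> s"
  shows "\<forall>\<^sub>F n in sequentially. \<lfloor>x - S n\<rfloor> = \<lfloor>x - s\<rfloor>"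
proof -
  \<comment> \<open>\<open>x - S n\<close> tends to \<open>x - s\<close> from above, where floor is
    continuous; the room subtracted from \<open>s\<close> is the distance from \<open>x - s\<close>
    to the next integer. So every \<open>x\<close> is covered, even when \<open>x - s\<close> is an
    integer.\<close>
  have "s - (of_int \<lfloor>x - s\<rfloor> + 1 - (x - s)) < s" by linarith
  from order_tendstoD(1)[OF assms(2) this] show ?thesis
    by eventually_elim (use assms(1) in \<open>smt (verit) floor_unique of_int_floor_le\<close>)
qed

lemma eventually_cocycle_eq:
  assumes "\<And>n. U n \<le> u" "U \<longlonglongrightarrow> u" "\<And>n. W n \<le> w" "W \<longlonglongrightarrow> w"
  shows "\<forall>\<^sub>F n in sequentially. cocycle (U n) (W n) x = cocycle u w x"
proof -
  have "\<forall>\<^sub>F n in sequentially. \<lfloor>x - (U n + W n)\<rfloor> = \<lfloor>x - (u + w)\<rfloor>"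
    using assms by (intro eventually_floor_diff_incseq tendsto_add add_mono)
  with eventually_floor_diff_incseq[OF assms(1,2), of x] eventually_floor_diff_incseq[OF assms(3,4), of x]
  show ?thesis by eventually_elim (simp add: cocycle_def)
qed

text \<open>The conjugate bounds \<open>|k|\<close> by a multiple of
  \<open>1 / silver ^ r n\<close>, so moving the other length by \<open>silver ^ (2 * r n)\<close>
  still costs little. The 3 is 1 for the partial sum plus 2 from
  \<open>lacunary_partial_conj_bound\<close>.\<close>

lemma lacunary_cost:
  assumes r: "lacunary r" and "lacunary_sum r \<le> 1"
  obtains l k where "lacunary_partial r (Suc n) = of_int l + of_int k * silver"
    "of_int \<bar>k\<bar> * silver ^ (2 * r n) \<le> 3 * silver ^ r n"
proof -
  obtain l k where k: "lacunary_partial r (Suc n) = of_int l + of_int k * silver"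
    "of_int \<bar>k\<bar> \<le> \<bar>lacunary_partial r (Suc n)\<bar> + \<bar>lacunary_partial_conj r (Suc n)\<bar>"
    using conjugates_coefficient_bound[OF conjugates_lacunary_partial] by blast
  have "\<bar>lacunary_partial r (Suc n)\<bar> \<le> 1"
    using lacunary_partial_nonneg[of r "Suc n"] lacunary_tail(1)[OF r, of "Suc n"] assms(2)
    by linarith
  then have "of_int \<bar>k\<bar> * silver ^ r n \<le> (1 + \<bar>lacunary_partial_conj r (Suc n)\<bar>) * silver ^ r n"
    using k(2) silver_bounds by (intro mult_right_mono) auto
  also have "\<dots> \<le> 3"
    using lacunary_partial_conj_bound[OF r, of n] silver_bounds power_le_one[of silver "r n"]
    by (simp add: distrib_right)
  finally have "(of_int \<bar>k\<bar> * silver ^ r n) * silver ^ r n \<le> 3 * silver ^ r n"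
    using silver_bounds by (intro mult_right_mono) auto
  then have "of_int \<bar>k\<bar> * silver ^ (2 * r n) \<le> 3 * silver ^ r n"
    by (simp add: mult_2 power_add mult.assoc)
  with k(1) show thesis by (rule that)
qed

lemma two_step_coboundary:
  obtains g where "periodic g" "support_size g \<le> 6 * silver ^ n"
    "\<And>x. g (x + silver) - g x =
       cocycle (lacunary_partial odd_exp (Suc n)) (lacunary_partial even_exp (Suc n)) x
       - cocycle (lacunary_partial odd_exp n) (lacunary_partial even_exp n) x"
proof -
  let ?U = "lacunary_partial odd_exp" and ?W = "lacunary_partial even_exp"
  have small: "lacunary_sum odd_exp \<le> 1" "lacunary_sum even_exp \<le> 1"
    using lacunary_sum_bounds by linarith+
  have nn: "n < 4 ^ n" for n :: nat by (simp add: power_gt_expt)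
  \<comment> \<open>First \<open>w\<close> moves with \<open>u\<close> fixed. At
    \<open>n = 0\<close> the length \<open>u\<close> is still 0 and the move is free; later
    \<open>even_exp n\<close> is twice the preceding odd exponent.\<close>
  have "\<exists>l k. ?U n = of_int l + of_int k * silver \<and> of_int \<bar>k\<bar> * silver ^ even_exp n \<le> 3 * silver ^ n"
  proof (cases n)
    case 0
    then show ?thesis using silver_bounds by (intro exI[of _ 0]) (simp add: lacunary_partial_def)
  next
    case (Suc m)
    have "even_exp (Suc m) = 2 * odd_exp m" by (simp add: even_exp_def odd_exp_def)
    moreover have "silver ^ odd_exp m \<le> silver ^ Suc m"
      using nn[of m] by (intro silver_power_le) (simp add: odd_exp_def)
    ultimately show ?thesis
      using lacunary_cost[OF lacunary_exps(2) small(1), of m] unfolding Suc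
      by (smt (verit, best))
  qed
  then obtain l k where k: "?U n = of_int l + of_int k * silver"
      "of_int \<bar>k\<bar> * silver ^ even_exp n \<le> 3 * silver ^ n"
    by blast
  obtain g where g: "periodic g" "support_size g \<le> of_int \<bar>k\<bar> * silver ^ even_exp n"
    "\<And>x. g (x + silver) - g x
        = cocycle (?U n) (?W n + silver ^ even_exp n) x - cocycle (?U n) (?W n) x"
    using cocycle_move_coboundary[OF k(1), of "silver ^ even_exp n" "?W n"] silver_bounds by auto
  \<comment> \<open>Then \<open>u\<close> moves with \<open>w\<close> already at stage
    \<open>Suc n\<close>, the increment being \<open>silver ^ (2 * even_exp n)\<close>. Each half
    costs at most \<open>3 * silver ^ n\<close>.\<close>
  obtain l' k' where k': "?W (Suc n) = of_int l' + of_int k' * silver"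
    "of_int \<bar>k'\<bar> * silver ^ (2 * even_exp n) \<le> 3 * silver ^ even_exp n"
    using lacunary_cost[OF lacunary_exps(1) small(2)] by blast
  have odd2: "odd_exp n = 2 * even_exp n" by (simp add: even_exp_def odd_exp_def)
  have "silver ^ even_exp n \<le> silver ^ n"
    using nn[of n] by (intro silver_power_le) (simp add: even_exp_def)
  obtain h where h: "periodic h" "support_size h \<le> of_int \<bar>k'\<bar> * silver ^ odd_exp n"
    "\<And>x. h (x + silver) - h x
        = cocycle (?W (Suc n)) (?U n + silver ^ odd_exp n) x - cocycle (?W (Suc n)) (?U n) x"
    using cocycle_move_coboundary[OF k'(1), of "silver ^ odd_exp n" "?U n"] silver_bounds by auto
  have Suc: "?U n + silver ^ odd_exp n = ?U (Suc n)" "?W n + silver ^ even_exp n = ?W (Suc n)"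
    by (simp_all add: lacunary_partial_def)
  show thesis
  proof (rule that[of "\<lambda>x. g x + h x"])
    show "periodic (\<lambda>x. g x + h x)" by (rule periodic_add[OF g(1) h(1)])
    show "support_size (\<lambda>x. g x + h x) \<le> 6 * silver ^ n"
      using support_size_add[OF g(1) h(1)] g(2) h(2) k(2) k'(2) \<open>silver ^ even_exp n \<le> _\<close>
      unfolding odd2 by linarith
    show "g (x + silver) + h (x + silver) - (g x + h x)
        = cocycle (?U (Suc n)) (?W (Suc n)) x - cocycle (?U n) (?W n) x" for x
      using g(3)[of x] h(3)[of x] unfolding Suc cocycle_commute[of "?W (Suc n)"] by simp
  qed
qed

lemma half_open_intervalI: "0 \<le> a \<Longrightarrow> a < b \<Longrightarrow> b \<le> 1 \<Longrightarrow> half_open_interval {a..<b}"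
  unfolding half_open_interval_def by blast

theorem theorem1:
  shows "\<exists>(\<alpha>::real) (T :: real \<times> bit \<Rightarrow> real \<times> bit).
           0 < \<alpha> \<and> \<alpha> < 1 \<and> badly_approximable \<alpha> \<and> two_interval_skew_product \<alpha> T \<and>
           minimal_map phase_space T \<and> \<not> uniquely_ergodic phase_space T"
proof (intro exI conjI)
  define u where "u = lacunary_sum odd_exp"
  define w where "w = lacunary_sum even_exp"
  let ?J = "{0..<u} \<union> {w..<w + u}"
  have uw: "0 < u" "u \<le> w" "u + w < 1"
    using lacunary_sum_bounds by (simp_all add: u_def w_def)
  have span: "u \<notin> int_span silver" "w \<notin> int_span silver" "u + w \<notin> int_span silver"
    using lacunary_exps
    by (simp_all add: u_def w_def lacunary_sum_even_odd lacunary_sum_notin_int_span)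
  show "0 < silver" "silver < 1" using silver_bounds by linarith+
  show "badly_approximable silver" by (rule badly_approximable_silver)
  show "two_interval_skew_product silver (skew_product silver ?J)"
    unfolding two_interval_skew_product_def
  proof (intro exI conjI)
    show "half_open_interval {0..<u}" using uw by (intro half_open_intervalI) linarith+
    show "half_open_interval {w..<w + u}" using uw by (intro half_open_intervalI) linarith+
    show "{0..<u} \<inter> {w..<w + u} = {}" using uw by auto
  qed (rule refl)
  show "minimal_map phase_space (skew_product silver ?J)"
    using uw span silver_irrational by (intro minimal_two_interval_skew_product) auto
  have "\<forall>n. \<exists>g. periodic g \<and> support_size g \<le> 6 * silver ^ n \<and> (\<forall>x. g (x + silver) - g x =
      cocycle (lacunary_partial odd_exp (Suc n)) (lacunary_partial even_exp (Suc n)) x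
      - cocycle (lacunary_partial odd_exp n) (lacunary_partial even_exp n) x)"
    using two_step_coboundary by metis
  then obtain g where g: "\<And>n. periodic (g n)" "\<And>n. support_size (g n) \<le> 6 * silver ^ n"
    "\<And>n x. g n (x + silver) - g n x =
      cocycle (lacunary_partial odd_exp (Suc n)) (lacunary_partial even_exp (Suc n)) x
      - cocycle (lacunary_partial odd_exp n) (lacunary_partial even_exp n) x"
    by metis
  have "summable (\<lambda>n. support_size (g n))"
  proof (rule summable_comparison_test')
    show "summable (\<lambda>n. 6 * silver ^ n)"
      using silver_bounds by (intro summable_mult summable_geometric) auto
    show "norm (support_size (g n)) \<le> 6 * silver ^ n" if "n \<ge> 0" for n
      using g(2)[of n] by (simp add: support_size_def)
  qed
  \<comment> \<open>Both lengths start at 0, so the telescoping starts from the zero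
    cocycle.\<close>
  moreover have "cocycle (lacunary_partial odd_exp 0) (lacunary_partial even_exp 0) x = 0" for x
    by (simp add: lacunary_partial_def cocycle_def)
  moreover have "\<forall>\<^sub>F n in sequentially.
      cocycle (lacunary_partial odd_exp n) (lacunary_partial even_exp n) x = cocycle u w x" for x
    unfolding u_def w_def
    using lacunary_tail(1)[OF lacunary_exps(1)] lacunary_tail(1)[OF lacunary_exps(2)]
    by (intro eventually_cocycle_eq lacunary_partial_tendsto lacunary_exps)
        (simp_all add: less_imp_le)
  ultimately obtain f :: "real \<Rightarrow> bit" where f: "f \<in> measurable circle_measure (count_space UNIV)"
    "AE x in circle_measure. f (frac (x + silver)) = f x + of_int (cocycle u w x)"
    using measurable_coboundary_limit[of g silver
        "\<lambda>n. cocycle (lacunary_partial odd_exp n) (lacunary_partial even_exp n)" "cocycle u w"] g(1,3)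
    by blast
  \<comment> \<open>The cocycle and the indicator agree modulo 2 on \<open>[0, 1)\<close>, the space
    of \<open>circle_measure\<close>.\<close>
  have "AE x in circle_measure. f (frac (x + silver)) = f x + indicator ?J x"
    using f(2) AE_space
  proof eventually_elim
    case (elim x)
    then show ?case
      using uw indicator_two_intervals_eq_cocycle[of u w x] by (simp add: space_restrict_space)
  qed
  then show "\<not> uniquely_ergodic phase_space (skew_product silver ?J)"
    using f(1) by (intro not_uniquely_ergodic_if_coboundary) auto
qed

end
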